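(* Consider the system $y_{t+1}=\theta f(y_t)+u_t+w_{t+1}$, $t\ge 0$, under the standing assumptions in the context. For $b\in\mathbb{R}$ and $L>0$ put $S_b^L=\{x\in\mathbb{R}: |f(x)|<L|x|^b\}$, and let $\ell$ denote Lebesgue measure on $\mathbb{R}$. Suppose that (i) for some $a\ge4$, $|f(x)|=O(|x|^a)+O(1)$ as $|x|\to+\infty$; (ii) there exist two numbers $b<(1+x_{\min})^2$ and $L>0$ such that $$\liminf_{l\to+\infty}\frac{\ell(S_b^L\cap[-l,l])}{l}\cdot\log(\log l)>0,$$ where $x_{\min}$ denotes the smallest solution of the equation $x^2-(a-2)x+1=0$. Then the system is globally stabilizable.
   Context: System: $y_{t+1}=\theta f(y_t)+u_t+w_{t+1}$, $t\ge0$, where $\theta\in\mathbb{R}$ is an unknown (random) parameter and $y_t,u_t,w_t\in\mathbb{R}$ are the output, input and noise. Standing assumptions: $f:\mathbb{R}\to\mathbb{R}$ is a known piecewise continuous function; the initial value $y_0$ is independent of $\theta$ and $\{w_t\}$; (A1) $\{w_t\}$ is an i.i.d. random sequence with $w_1\sim N(0,1)$; (A2) $\theta\sim N(\theta_0,P_0)$, with $P_0>0$, is independent of $\{w_t\}$. A feedback control law is a sequence $\{u_t\}_{t\ge0}$ such that $u_t$ is measurable with respect to $\mathcal{F}_t^y=\sigma\{y_i:0\le i\le t\}$ for every $t\ge0$. Definition: the system is globally stabilizable if there exists a feedback control law $\{u_t\}$ such that for any initial $y_0\in\mathbb{R}$, $\sup_{t\ge1}\frac1t\sum_{i=1}^t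 y_i^2<+\infty$ almost surely. *)

theory Defs
  imports "HOL-Probability.Probability"
begin

text \<open>
  Piecewise continuity on the real line in the standard sense: every bounded interval contains only
  finitely many discontinuities, and each of them is a jump (both one-sided limits exist and are
  finite). The value at a jump is arbitrary. At a continuity point the one-sided limits exist anyway.
\<close>

definition piecewise_continuous :: "(real \<Rightarrow> real) \<Rightarrow> bool" where
  "piecewise_continuous f \<longleftrightarrow>
     (\<forall>a b. finite {x \<in> {a..b}. \<not> isCont f x}) \<and>
     (\<forall>x. (\<exists>l. (f \<longlongrightarrow> l) (at_left x)) \<and> (\<exists>r. (f \<longlongrightarrow> r) (at_right x)))"

text \<open>The \<open>\<sigma>\<close>-algebra on \<open>\<Omega>\<close> generated by \<open>y 0, \<dots>, y t\<close>.\<close>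

definition output_sigma :: "'w set \<Rightarrow> (nat \<Rightarrow> 'w \<Rightarrow> real) \<Rightarrow> nat \<Rightarrow> 'w measure" where
  "output_sigma \<Omega> y t = (SUP i\<in>{..t}. vimage_algebra \<Omega> (y i) borel)"

text \<open>
  The input depends on the trajectory and the trajectory on the input, and one and the same control
  law has to serve every initial value. A control law is therefore a family of functionals \<open>g t\<close> of
  the output path \<open>y\<close>, measurable with respect to the \<open>\<sigma>\<close>-algebra generated by the coordinates
  \<open>y 0, \<dots>, y t\<close> on path space; the input is \<open>u t = g t y\<close>.
\<close>

definition feedback_law :: "(nat \<Rightarrow> (nat \<Rightarrow> real) \<Rightarrow> real) \<Rightarrow> bool" where
  "feedback_law g \<longleftrightarrow> (\<forall>t. g t \<in> borel_measurable (output_sigma UNIV (\<lambda>i y. y i) t))"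

definition closed_loop ::
  "'w measure \<Rightarrow> (real \<Rightarrow> real) \<Rightarrow> ('w \<Rightarrow> real) \<Rightarrow> (nat \<Rightarrow> 'w \<Rightarrow> real) \<Rightarrow>
    (nat \<Rightarrow> (nat \<Rightarrow> real) \<Rightarrow> real) \<Rightarrow> ('w \<Rightarrow> real) \<Rightarrow> (nat \<Rightarrow> 'w \<Rightarrow> real) \<Rightarrow> bool" where
  "closed_loop M f \<theta> w g y0 y \<longleftrightarrow>
     (\<forall>\<omega>\<in>space M. y 0 \<omega> = y0 \<omega> \<and>
        (\<forall>t. y (Suc t) \<omega> = \<theta> \<omega> * f (y t \<omega>) + g t (\<lambda>i. y i \<omega>) + w (Suc t) \<omega>))"

text \<open>Only \<open>w 1, w 2, \<dots>\<close> enter the system.\<close>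

definition noise :: "(nat \<Rightarrow> 'w \<Rightarrow> real) \<Rightarrow> 'w \<Rightarrow> nat \<Rightarrow> real" where
  "noise w \<omega> = (\<lambda>t\<in>{1..}. w t \<omega>)"

text \<open>
  Independence of two random variables with values in different types, as independence of the
  generated \<open>\<sigma>\<close>-algebras; \<open>prob_space.indep_var\<close> requires both ranges to have the same type.
\<close>

definition independent_rv ::
  "'w measure \<Rightarrow> 'b measure \<Rightarrow> ('w \<Rightarrow> 'b) \<Rightarrow> 'c measure \<Rightarrow> ('w \<Rightarrow> 'c) \<Rightarrow> bool" where
  "independent_rv M N X K Y \<longleftrightarrow>
     X \<in> M \<rightarrow>\<^sub>M N \<and> Y \<in> M \<rightarrow>\<^sub>M K \<and>
     prob_space.indep_set M {X -` A \<inter> space M | A. A \<in> sets N} {Y -` B \<inter> space M | B. B \<in> sets K}"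

text \<open>
  The initial value is independent of \<open>\<theta>\<close> and the noise jointly; deterministic initial values
  are included.
\<close>

definition admissible_initial ::
  "'w measure \<Rightarrow> ('w \<Rightarrow> real) \<Rightarrow> (nat \<Rightarrow> 'w \<Rightarrow> real) \<Rightarrow> ('w \<Rightarrow> real) \<Rightarrow> bool" where
  "admissible_initial M \<theta> w y0 \<longleftrightarrow>
     independent_rv M borel y0
       (borel \<Otimes>\<^sub>M (\<Pi>\<^sub>M t\<in>{1..}. borel)) (\<lambda>\<omega>. (\<theta> \<omega>, noise w \<omega>))"

definition globally_stabilizable ::
  "'w measure \<Rightarrow> (real \<Rightarrow> real) \<Rightarrow> ('w \<Rightarrow> real) \<Rightarrow> (nat \<Rightarrow> 'w \<Rightarrow> real) \<Rightarrow> bool" where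
  "globally_stabilizable M f \<theta> w \<longleftrightarrow>
     (\<exists>g. feedback_law g \<and>
       (\<forall>y0 y. admissible_initial M \<theta> w y0 \<and> closed_loop M f \<theta> w g y0 y \<longrightarrow>
         (AE \<omega> in M. (SUP t\<in>{1..}. ereal (1 / real t * (\<Sum>i=1..t. (y i \<omega>)\<^sup>2))) < \<infinity>)))"

text \<open>
  At \<open>x = 0\<close> the value of \<open>\<bar>x\<bar> powr b\<close> is \<open>0\<close> for every \<open>b\<close>; this single point does not affect
  Lebesgue measure.
\<close>

definition S_set :: "(real \<Rightarrow> real) \<Rightarrow> real \<Rightarrow> real \<Rightarrow> real set" where
  "S_set f b L = {x. \<bar>f x\<bar> < L * \<bar>x\<bar> powr b}"

definition x_min :: "real \<Rightarrow> real" where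
  "x_min a = (LEAST x. x\<^sup>2 - (a - 2) * x + 1 = 0)"


text \<open>
  Consistency of the definitions: deterministic initial values are admissible, inputs produced by a feedback law are adapted to the output,
  the law is causal, and every initial value has exactly one trajectory.
\<close>

lemma admissible_initial_const:
  assumes M: "prob_space M" and \<theta>: "\<theta> \<in> borel_measurable M"
    and w: "\<And>t. t \<ge> 1 \<Longrightarrow> w t \<in> borel_measurable M"
  shows "admissible_initial M \<theta> w (\<lambda>_. c)"
proof -
  interpret prob_space M by fact
  let ?K = "borel \<Otimes>\<^sub>M (\<Pi>\<^sub>M t\<in>{1..}. borel) :: (real \<times> (nat \<Rightarrow> real)) measure"
  have meas: "(\<lambda>\<omega>. (\<theta> \<omega>, noise w \<omega>)) \<in> M \<rightarrow>\<^sub>M ?K"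
    unfolding noise_def using \<theta> w
    by (intro measurable_Pair measurable_restrict) auto
  have "indep_set {(\<lambda>_. c) -` A \<inter> space M | A. A \<in> sets borel}
      {(\<lambda>\<omega>. (\<theta> \<omega>, noise w \<omega>)) -` B \<inter> space M | B. B \<in> sets ?K}"
    unfolding indep_sets2_eq
  proof (intro conjI ballI)
    fix a b
    assume "a \<in> {(\<lambda>_. c) -` A \<inter> space M | A. A \<in> sets borel}"
      and b: "b \<in> {(\<lambda>\<omega>. (\<theta> \<omega>, noise w \<omega>)) -` B \<inter> space M | B. B \<in> sets ?K}"
    then have "a = space M \<or> a = {}" by (auto simp: vimage_def split: if_splits)
    moreover have "space M \<inter> b = b" using b by auto
    ultimately show "prob (a \<inter> b) = prob a * prob b"
      by (auto simp: prob_space)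
  qed (use measurable_sets[OF meas] in \<open>auto simp: vimage_def\<close>)
  then show ?thesis
    using meas by (simp add: admissible_initial_def independent_rv_def)
qed

lemma feedback_law_adapted:
  assumes "feedback_law g"
  shows "(\<lambda>\<omega>. g t (\<lambda>i. y i \<omega>)) \<in> borel_measurable (output_sigma \<Omega> y t)"
proof -
  have "(\<lambda>\<omega> i. y i \<omega>) \<in> output_sigma \<Omega> y t \<rightarrow>\<^sub>M output_sigma UNIV (\<lambda>i y. y i) t"
    unfolding output_sigma_def[of UNIV]
  proof (rule measurable_SUP2)
    fix j assume j: "j \<in> {..t}"
    have "y j \<in> borel_measurable (output_sigma \<Omega> y t)"
      unfolding output_sigma_def
      by (rule measurable_Sup1[of "vimage_algebra \<Omega> (y j) borel"])
         (use j in \<open>auto intro!: measurable_vimage_algebra1\<close>)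
    then show "(\<lambda>\<omega> i. y i \<omega>) \<in> output_sigma \<Omega> y t \<rightarrow>\<^sub>M vimage_algebra UNIV (\<lambda>y. y j) borel"
      by (intro measurable_vimage_algebra2) auto
  qed auto
  moreover have "g t \<in> borel_measurable (output_sigma UNIV (\<lambda>i y. y i) t)"
    using assms by (auto simp: feedback_law_def)
  ultimately show ?thesis
    using measurable_compose by blast
qed

lemma feedback_law_causal:
  assumes g: "feedback_law g" and eq: "\<And>i. i \<le> t \<Longrightarrow> y i = z i"
  shows "g t y = g t z"
proof -
  let ?F = "output_sigma UNIV (\<lambda>i y. y i) t :: (nat \<Rightarrow> real) measure"
  have space: "space ?F = UNIV"
    unfolding output_sigma_def by (subst space_Sup_eq_UN) auto
  have sets: "sets ?F = sigma_sets UNIV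
      (\<Union>m\<in>(\<lambda>i. vimage_algebra UNIV (\<lambda>y. y i) borel) ` {..t}. sets m)"
    unfolding output_sigma_def by (rule sets_Sup_eq) auto
  have inv: "y \<in> A \<longleftrightarrow> z \<in> A" if "A \<in> sets ?F" for A
    using that unfolding sets
  proof (induction rule: sigma_sets.induct)
    case (Basic a)
    then obtain i where "i \<le> t" "a \<in> sets (vimage_algebra UNIV (\<lambda>y. y i) borel)"
      by auto
    then show ?case using eq[of i] by (auto simp: sets_vimage_algebra2)
  qed auto
  have "g t -` {g t y} \<inter> space ?F \<in> sets ?F"
    using g by (intro measurable_sets[of "g t" ?F borel]) (auto simp: feedback_law_def)
  from inv[OF this] show ?thesis by (simp add: space)
qed

lemma closed_loop_exists:
  assumes g: "feedback_law g"
  shows "\<exists>y. closed_loop M f \<theta> w g y0 y"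
proof -
  define Y where "Y = (\<lambda>\<omega>. rec_nat (\<lambda>_::nat. y0 \<omega>)
    (\<lambda>n p. p(Suc n := \<theta> \<omega> * f (p n) + g n p + w (Suc n) \<omega>)))"
  have Y0: "Y \<omega> 0 = (\<lambda>_. y0 \<omega>)"
    and YS: "Y \<omega> (Suc n) = (Y \<omega> n)(Suc n := \<theta> \<omega> * f (Y \<omega> n n) + g n (Y \<omega> n) + w (Suc n) \<omega>)"
    for \<omega> n by (simp_all add: Y_def)
  have stable: "i \<le> n \<Longrightarrow> Y \<omega> n i = Y \<omega> i i" for \<omega> n i
    by (induction n) (auto simp: YS le_Suc_eq)
  have "g n (Y \<omega> n) = g n (\<lambda>i. Y \<omega> i i)" for \<omega> n
    by (rule feedback_law_causal[OF g]) (rule stable)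
  then have "closed_loop M f \<theta> w g y0 (\<lambda>t \<omega>. Y \<omega> t t)"
    by (simp add: closed_loop_def Y0 YS)
  then show ?thesis by blast
qed

lemma closed_loop_unique:
  assumes g: "feedback_law g"
    and y: "closed_loop M f \<theta> w g y0 y" and z: "closed_loop M f \<theta> w g y0 z"
    and \<omega>: "\<omega> \<in> space M"
  shows "y t \<omega> = z t \<omega>"
proof (induction t rule: less_induct)
  case (less t)
  show ?case
  proof (cases t)
    case 0
    then show ?thesis using y z \<omega> by (simp add: closed_loop_def)
  next
    case (Suc n)
    have "g n (\<lambda>i. y i \<omega>) = g n (\<lambda>i. z i \<omega>)"
      by (rule feedback_law_causal[OF g]) (use less Suc in auto)
    moreover have "y n \<omega> = z n \<omega>" using less Suc by simp
    ultimately show ?thesis using y z \<omega> Suc by (simp add: closed_loop_def)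
  qed
qed

end

theory Submission
  imports Defs "HOL-Real_Asymp.Real_Asymp"
begin

text \<open>
  Take the certainty-equivalence law \<open>u t = - est t * f (y t)\<close> with \<open>est t\<close> the Bayesian estimate of \<open>\<theta>\<close>.
  Given \<open>y 0, \<dots>, y t\<close> the parameter is \<open>N (est t, 1 / r t)\<close> with \<open>r t = 1 / P0 + (\<Sum>i<t. f (y i)^2)\<close>, so
  \<open>y (t + 1)\<close> is conditionally \<open>N (0, s t^2)\<close> with \<open>s t^2 = r (t + 1) / r t\<close>, and the innovations
  \<open>y (t + 1) / s t\<close> are i.i.d. standard normal.

  Once \<open>s t^2 \<le> 2\<close> at a late time, this persists, because \<open>y\<close> is then of order \<open>sqrt (ln t)\<close> while \<open>r t\<close>
  grows linearly (unless \<open>f\<close> vanishes almost everywhere, when \<open>s t = 1\<close>). Suppose instead that \<open>s t^2 > 2\<close> forever. Then \<open>q t = ln (r (t + 1)) / ln (r t)\<close> satisfies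
  \<open>q (t + 1) \<le> a (1 - 1 / q t) + o(1)\<close>, a recursion with fixed points \<open>z = 1 + x_min a\<close> (repelling)
  and \<open>Z = a - z\<close>, so \<open>limsup q \<le> Z\<close> and \<open>ln (ln (s t)) = O(t)\<close>. By the density
  assumption \<open>y (t + 1)\<close> falls into the set \<open>S_set f b L\<close> with conditional probability at least of order \<open>1 / t\<close>, hence
  infinitely often. Such a hit gives \<open>q (t + 1) \<le> b (1 - 1 / Z) + o(1) = b / z + o(1) < z\<close>, and below \<open>z\<close> the recursion drives \<open>q\<close>
  under \<open>1\<close>, which is absurd since \<open>r\<close> is increasing.
\<close>

section \<open>Independence and normal densities\<close>

text \<open>Independence makes the joint law the product of the marginals, since the two agree on
  rectangles; Tonelli then splits the integral. The two variables may take values in different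
  types, as \<open>y0\<close> and the pair of parameter and noise sequence do.\<close>

lemma (in prob_space) nn_integral_indep_set:
  assumes X[measurable]: "X \<in> M \<rightarrow>\<^sub>M N" and Y[measurable]: "Y \<in> M \<rightarrow>\<^sub>M K"
    and ind: "indep_set {X -` A \<inter> space M | A. A \<in> sets N} {Y -` B \<inter> space M | B. B \<in> sets K}"
    and h[measurable]: "h \<in> borel_measurable (N \<Otimes>\<^sub>M K)"
  shows "(\<integral>\<^sup>+\<omega>. h (X \<omega>, Y \<omega>) \<partial>M) = (\<integral>\<^sup>+\<omega>. (\<integral>\<^sup>+\<omega>'. h (X \<omega>, Y \<omega>') \<partial>M) \<partial>M)"
proof -
  interpret X: prob_space "distr M N X" by (rule prob_space_distr) fact
  interpret Y: prob_space "distr M K Y" by (rule prob_space_distr) fact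
  have eq: "distr M N X \<Otimes>\<^sub>M distr M K Y = distr M (N \<Otimes>\<^sub>M K) (\<lambda>\<omega>. (X \<omega>, Y \<omega>))"
  proof (rule pair_measure_eqI)
    fix A B assume "A \<in> sets (distr M N X)" "B \<in> sets (distr M K Y)"
    then have A[measurable]: "A \<in> sets N" and B[measurable]: "B \<in> sets K" by simp_all
    have "prob ((X -` A \<inter> space M) \<inter> (Y -` B \<inter> space M)) = prob (X -` A \<inter> space M) * prob (Y -` B \<inter> space M)"
      by (rule indep_setD[OF ind]) (use A B in auto)
    moreover have "(\<lambda>\<omega>. (X \<omega>, Y \<omega>)) -` (A \<times> B) \<inter> space M = (X -` A \<inter> space M) \<inter> (Y -` B \<inter> space M)"
      by auto
    ultimately show "emeasure (distr M N X) A * emeasure (distr M K Y) B =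
        emeasure (distr M (N \<Otimes>\<^sub>M K) (\<lambda>\<omega>. (X \<omega>, Y \<omega>))) (A \<times> B)"
      by (simp add: emeasure_distr emeasure_eq_measure ennreal_mult')
  qed (use X.sigma_finite_measure_axioms Y.sigma_finite_measure_axioms in \<open>auto cong: sets_pair_measure_cong\<close>)
  have "(\<integral>\<^sup>+\<omega>. h (X \<omega>, Y \<omega>) \<partial>M) = integral\<^sup>N (distr M (N \<Otimes>\<^sub>M K) (\<lambda>\<omega>. (X \<omega>, Y \<omega>))) h"
    by (simp add: nn_integral_distr)
  also have "\<dots> = (\<integral>\<^sup>+x. (\<integral>\<^sup>+y. h (x, y) \<partial>distr M K Y) \<partial>distr M N X)"
    unfolding eq[symmetric] by (subst Y.nn_integral_fst[symmetric]) simp_all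
  also have "\<dots> = (\<integral>\<^sup>+x. (\<integral>\<^sup>+\<omega>'. h (x, Y \<omega>') \<partial>M) \<partial>distr M N X)"
    by (intro nn_integral_cong) (simp add: nn_integral_distr)
  also have "\<dots> = (\<integral>\<^sup>+\<omega>. (\<integral>\<^sup>+\<omega>'. h (X \<omega>, Y \<omega>') \<partial>M) \<partial>M)"
    by (subst nn_integral_distr) simp_all
  finally show ?thesis .
qed

lemma nn_integral_normal_density: "\<sigma> > 0 \<Longrightarrow> (\<integral>\<^sup>+x. ennreal (normal_density \<mu> \<sigma> x) \<partial>lborel) = 1"
  by (subst nn_integral_eq_integral) auto

text \<open>Bayes' rule for a Gaussian prior with precision \<open>r\<close> and an observation with
  prediction error \<open>s\<close> and gain \<open>c\<close>: completing the square in
  \<open>z\<close> writes likelihood times prior as predictive density times posterior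
  density.\<close>

lemma normal_density_posterior:
  assumes r: "r > 0"
  shows "normal_density 0 1 (s - (z - m) * c) * normal_density m (1 / sqrt r) z =
    normal_density 0 (sqrt ((r + c\<^sup>2) / r)) s * normal_density (m + c * s / (r + c\<^sup>2)) (1 / sqrt (r + c\<^sup>2)) z"
proof -
  define q where "q = r + c\<^sup>2"
  have q: "q > 0" using r by (simp add: q_def add_pos_nonneg)
  have e: "(s - (z - m) * c)\<^sup>2 + r * (z - m)\<^sup>2 = s\<^sup>2 * r / q + q * (z - (m + c * s / q))\<^sup>2"
  proof -
    have "q * (z - (m + c * s / q))\<^sup>2 = q * (z - m)\<^sup>2 - 2 * c * s * (z - m) + c\<^sup>2 * s\<^sup>2 / q"
      using q by (simp add: field_simps power2_eq_square)
    moreover have "s\<^sup>2 * r / q + c\<^sup>2 * s\<^sup>2 / q = s\<^sup>2"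
    proof -
      have "(r + c\<^sup>2) * s\<^sup>2 / q = s\<^sup>2"
        using q by (simp add: q_def[symmetric])
      moreover have "(r + c\<^sup>2) * s\<^sup>2 / q = s\<^sup>2 * r / q + c\<^sup>2 * s\<^sup>2 / q"
        by (simp add: add_divide_distrib[symmetric] distrib_left mult.commute)
      ultimately show ?thesis by simp
    qed
    ultimately show ?thesis by (simp add: q_def algebra_simps power2_eq_square)
  qed
  have n1: "normal_density 0 1 (s - (z - m) * c) * normal_density m (1 / sqrt r) z =
     1 / sqrt (2 * pi) * (sqrt r / sqrt (2 * pi)) * exp (- ((s - (z - m) * c)\<^sup>2 + r * (z - m)\<^sup>2) / 2)"
    using r by (simp add: normal_density_def power_divide real_sqrt_divide real_sqrt_mult exp_add[symmetric] field_simps)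
  have n2: "normal_density 0 (sqrt (q / r)) s * normal_density (m + c * s / q) (1 / sqrt q) z =
     1 / sqrt (2 * pi) * (sqrt r / sqrt (2 * pi)) * exp (- (s\<^sup>2 * r / q + q * (z - (m + c * s / q))\<^sup>2) / 2)"
  proof -
    have "normal_density 0 (sqrt (q / r)) s = sqrt r / (sqrt (2 * pi) * sqrt q) * exp (- (s\<^sup>2 * r / q) / 2)"
      using r q by (simp add: normal_density_def real_sqrt_divide real_sqrt_mult field_simps)
    moreover have "normal_density (m + c * s / q) (1 / sqrt q) z =
        sqrt q / sqrt (2 * pi) * exp (- (q * (z - (m + c * s / q))\<^sup>2) / 2)"
      using q by (simp add: normal_density_def power_divide real_sqrt_divide real_sqrt_mult)
    moreover have "exp (- (s\<^sup>2 * r / q) / 2) * exp (- (q * (z - (m + c * s / q))\<^sup>2) / 2) =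
       exp (- (s\<^sup>2 * r / q + q * (z - (m + c * s / q))\<^sup>2) / 2)"
      by (simp add: exp_add[symmetric] diff_divide_distrib)
    ultimately show ?thesis using q by simp
  qed
  show ?thesis
    unfolding q_def[symmetric] n1 n2 e ..
qed

section \<open>The Bayesian filter and the certainty-equivalence law\<close>

definition information :: "(real \<Rightarrow> real) \<Rightarrow> real \<Rightarrow> nat \<Rightarrow> (nat \<Rightarrow> real) \<Rightarrow> real" where
  "information f P0 t p = 1 / P0 + (\<Sum>i<t. (f (p i))\<^sup>2)"

text \<open>
  The Bayesian filter in closed form: under \<open>ce_law\<close> the predicted value of \<open>p (Suc i)\<close> is \<open>0\<close>, so the
  filter is corrected by \<open>p (Suc i)\<close> itself.
\<close>

definition estimate :: "(real \<Rightarrow> real) \<Rightarrow> real \<Rightarrow> real \<Rightarrow> nat \<Rightarrow> (nat \<Rightarrow> real) \<Rightarrow> real" where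
  "estimate f \<theta>0 P0 t p = \<theta>0 + (\<Sum>i<t. f (p i) * p (Suc i) / information f P0 (Suc i) p)"

definition ce_law :: "(real \<Rightarrow> real) \<Rightarrow> real \<Rightarrow> real \<Rightarrow> nat \<Rightarrow> (nat \<Rightarrow> real) \<Rightarrow> real" where
  "ce_law f \<theta>0 P0 t p = - estimate f \<theta>0 P0 t p * f (p t)"

text \<open>The next output has conditional variance
  \<open>1 + (f (p t))\<^sup>2 / information f P0 t p\<close>, unit noise plus uncertainty about the
  parameter. The quotient form makes its logarithm an increment of the log-information.\<close>

definition predictive_sd :: "(real \<Rightarrow> real) \<Rightarrow> real \<Rightarrow> nat \<Rightarrow> (nat \<Rightarrow> real) \<Rightarrow> real" where
  "predictive_sd f P0 t p = sqrt (information f P0 (Suc t) p / information f P0 t p)"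

lemma information_Suc: "information f P0 (Suc t) p = information f P0 t p + (f (p t))\<^sup>2"
  by (simp add: information_def)

lemma information_mono: "s \<le> t \<Longrightarrow> information f P0 s p \<le> information f P0 t p"
  by (auto simp: information_def intro!: sum_mono2)

lemma information_pos: "P0 > 0 \<Longrightarrow> information f P0 t p > 0"
  by (simp add: information_def add_pos_nonneg sum_nonneg)

lemma predictive_sd_ge_1: "P0 > 0 \<Longrightarrow> predictive_sd f P0 t p \<ge> 1"
  using information_pos[of P0 f t p] information_mono[of t "Suc t" f P0 p] by (simp add: predictive_sd_def)

lemma predictive_sd_power2: "P0 > 0 \<Longrightarrow> (predictive_sd f P0 t p)\<^sup>2 = information f P0 (Suc t) p / information f P0 t p"
  using information_pos[of P0 f t p] information_pos[of P0 f "Suc t" p] by (simp add: predictive_sd_def)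

lemma information_cong: "(\<And>i. i < t \<Longrightarrow> p i = q i) \<Longrightarrow> information f P0 t p = information f P0 t q"
  by (simp add: information_def)

lemma predictive_sd_cong: "(\<And>i. i \<le> t \<Longrightarrow> p i = q i) \<Longrightarrow> predictive_sd f P0 t p = predictive_sd f P0 t q"
  unfolding predictive_sd_def by (intro arg_cong[where f=sqrt] arg_cong2[where f="(/)"] information_cong) auto

lemma estimate_cong:
  assumes "\<And>i. i \<le> t \<Longrightarrow> p i = q i" shows "estimate f \<theta>0 P0 t p = estimate f \<theta>0 P0 t q"
  unfolding estimate_def
  by (intro arg_cong[where f="(+) \<theta>0"] sum.cong arg_cong2[where f="(/)"] arg_cong2[where f="(*)"] information_cong)
     (use assms in auto)

lemma feedback_law_ce_law:
  assumes [measurable]: "f \<in> borel_measurable borel"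
  shows "feedback_law (ce_law f \<theta>0 P0)"
  unfolding feedback_law_def
proof
  fix t
  have [measurable]: "(\<lambda>y. y i) \<in> borel_measurable (output_sigma UNIV (\<lambda>i y. y i) t)" if "i \<le> t" for i
    unfolding output_sigma_def
    by (rule measurable_Sup1[of "vimage_algebra UNIV (\<lambda>y. y i) borel"])
       (use that in \<open>auto intro!: measurable_vimage_algebra1\<close>)
  show "ce_law f \<theta>0 P0 t \<in> borel_measurable (output_sigma UNIV (\<lambda>i y. y i) t)"
    unfolding ce_law_def[abs_def] estimate_def information_def
    by (intro borel_measurable_times borel_measurable_uminus borel_measurable_add borel_measurable_sum
         borel_measurable_divide borel_measurable_const borel_measurable_power) (auto intro!: measurable_compose[of _ _ borel f])
qed

abbreviation paths :: "(nat \<Rightarrow> real) measure" where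
  "paths \<equiv> \<Pi>\<^sub>M i\<in>UNIV. borel"

context
  fixes f :: "real \<Rightarrow> real" and P0 \<theta>0 :: real
  assumes [measurable]: "f \<in> borel_measurable borel"
begin

lemma measurable_information[measurable]: "information f P0 t \<in> borel_measurable paths"
  unfolding information_def[abs_def] by measurable

lemma measurable_estimate[measurable]: "estimate f \<theta>0 P0 t \<in> borel_measurable paths"
  unfolding estimate_def[abs_def] by measurable

lemma measurable_predictive_sd[measurable]: "predictive_sd f P0 t \<in> borel_measurable paths"
  unfolding predictive_sd_def[abs_def] by measurable

lemma measurable_ce_law[measurable]: "ce_law f \<theta>0 P0 t \<in> borel_measurable paths"
  unfolding ce_law_def[abs_def] by measurable

end

section \<open>The closed loop and its innovations\<close>

text \<open>Grouping independent variables into disjoint blocks keeps them independent; the block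
  consisting of the single index \<open>Suc t\<close> is then identified with
  \<open>w (Suc t)\<close> itself.\<close>

lemma (in prob_space) indep_vars_past_next:
  fixes w :: "nat \<Rightarrow> 'a \<Rightarrow> real"
  assumes ind: "indep_vars (\<lambda>_. borel) w {1..}"
  shows "indep_set {(\<lambda>\<omega>. restrict (\<lambda>i. w i \<omega>) {1..t}) -` A \<inter> space M | A. A \<in> sets (\<Pi>\<^sub>M i\<in>{1..t}. borel)}
    {w (Suc t) -` B \<inter> space M | B. B \<in> sets borel}"
proof -
  have "indep_var (\<Pi>\<^sub>M i\<in>{1..t}. borel) (\<lambda>\<omega>. restrict (\<lambda>i. w i \<omega>) {1..t})
      (\<Pi>\<^sub>M i\<in>{Suc t}. borel) (\<lambda>\<omega>. restrict (\<lambda>i. w i \<omega>) {Suc t})"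
    by (rule indep_var_restrict[OF ind]) auto
  then have ind2: "indep_set
      (sigma_sets (space M) {(\<lambda>\<omega>. restrict (\<lambda>i. w i \<omega>) {1..t}) -` A \<inter> space M | A. A \<in> sets (\<Pi>\<^sub>M i\<in>{1..t}. borel)})
      (sigma_sets (space M) {(\<lambda>\<omega>. restrict (\<lambda>i. w i \<omega>) {Suc t}) -` A \<inter> space M | A. A \<in> sets (\<Pi>\<^sub>M i\<in>{Suc t}. borel)})"
    unfolding indep_var_eq by blast
  have "\<exists>A. w (Suc t) -` B \<inter> space M = (\<lambda>\<omega>. restrict (\<lambda>i. w i \<omega>) {Suc t}) -` A \<inter> space M \<and>
      A \<in> sets (\<Pi>\<^sub>M i\<in>{Suc t}. borel)" if "B \<in> sets borel" for B :: "real set"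
    using that by (intro exI[of _ "PiE {Suc t} (\<lambda>_. B)"]) (auto intro!: sets_PiM_I_finite)
  then have "{w (Suc t) -` B \<inter> space M | B. B \<in> sets borel} \<subseteq>
      {(\<lambda>\<omega>. restrict (\<lambda>i. w i \<omega>) {Suc t}) -` A \<inter> space M | A. A \<in> sets (\<Pi>\<^sub>M i\<in>{Suc t}. borel)}"
    by blast
  then have "{w (Suc t) -` B \<inter> space M | B. B \<in> sets borel} \<subseteq>
      sigma_sets (space M) {(\<lambda>\<omega>. restrict (\<lambda>i. w i \<omega>) {Suc t}) -` A \<inter> space M | A. A \<in> sets (\<Pi>\<^sub>M i\<in>{Suc t}. borel)}"
    using sigma_sets_superset_generator by (rule order_trans)
  then show ?thesis
    using ind2 sigma_sets_superset_generator unfolding indep_sets2_eq by (meson subset_iff order_trans)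
qed

text \<open>The closed loop solved explicitly in terms of initial value, parameter and noise. A
  whole path is carried along because the law acts on paths; the coordinates after time
  \<open>t\<close> hold the filler value \<open>c\<close>.\<close>

primrec trajectory ::
  "(nat \<Rightarrow> (nat \<Rightarrow> real) \<Rightarrow> real) \<Rightarrow> (real \<Rightarrow> real) \<Rightarrow> real \<Rightarrow> real \<Rightarrow> (nat \<Rightarrow> real) \<Rightarrow> nat \<Rightarrow> nat \<Rightarrow> real" where
  "trajectory g f c z \<nu> 0 = (\<lambda>_. c)"
| "trajectory g f c z \<nu> (Suc t) = (trajectory g f c z \<nu> t)
    (Suc t := z * f (trajectory g f c z \<nu> t t) + g t (trajectory g f c z \<nu> t) + \<nu> (Suc t))"

lemma trajectory_cong: "(\<And>i. i \<in> {1..t} \<Longrightarrow> \<nu> i = \<nu>' i) \<Longrightarrow> trajectory g f c z \<nu> t = trajectory g f c z \<nu>' t"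
  by (induction t) auto

text \<open>The noise argument is restricted to \<open>{1..T}\<close>, which records that the path
  up to time \<open>t\<close> is a function of the noise up to \<open>T\<close> only. This is what
  makes the next noise independent of it.\<close>

lemma measurable_trajectory:
  assumes [measurable]: "f \<in> borel_measurable borel" "\<And>t. g t \<in> borel_measurable paths"
  shows "t \<le> T \<Longrightarrow> (\<lambda>x. trajectory g f (fst x) (fst (snd x)) (snd (snd x)) t)
    \<in> borel \<Otimes>\<^sub>M borel \<Otimes>\<^sub>M (\<Pi>\<^sub>M i\<in>{1..T}. borel) \<rightarrow>\<^sub>M paths"
proof (induction t)
  case 0
  show ?case
    unfolding trajectory.simps by (rule measurable_PiM_single') auto
next
  case (Suc t)
  then have [measurable]: "(\<lambda>x. trajectory g f (fst x) (fst (snd x)) (snd (snd x)) t)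
      \<in> borel \<Otimes>\<^sub>M borel \<Otimes>\<^sub>M (\<Pi>\<^sub>M i\<in>{1..T}. borel) \<rightarrow>\<^sub>M paths"
    by simp
  have 1: "(\<lambda>x. snd (snd x) (Suc t)) \<in> borel_measurable (borel \<Otimes>\<^sub>M borel \<Otimes>\<^sub>M (\<Pi>\<^sub>M i\<in>{1..T}. borel))"
    by (rule measurable_compose[OF _ measurable_component_singleton[of "Suc t" "{1..T}"]]) (use Suc.prems in simp_all)
  have 2: "(\<lambda>x. fst (snd x) * f (trajectory g f (fst x) (fst (snd x)) (snd (snd x)) t t) +
      g t (trajectory g f (fst x) (fst (snd x)) (snd (snd x)) t))
      \<in> borel_measurable (borel \<Otimes>\<^sub>M borel \<Otimes>\<^sub>M (\<Pi>\<^sub>M i\<in>{1..T}. borel))"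
    by measurable
  show ?case
    unfolding trajectory.simps
    by (rule measurable_fun_upd[where J=UNIV]) (simp, fact, intro borel_measurable_add 1 2)
qed

locale certainty_equivalence = prob_space M for M :: "'w measure" +
  fixes f :: "real \<Rightarrow> real" and \<theta> :: "'w \<Rightarrow> real" and w :: "nat \<Rightarrow> 'w \<Rightarrow> real"
    and \<theta>0 P0 :: real and y0 :: "'w \<Rightarrow> real" and y :: "nat \<Rightarrow> 'w \<Rightarrow> real"
  assumes f_measurable[measurable]: "f \<in> borel_measurable borel"
    and noise_indep: "indep_vars (\<lambda>_. borel) w {1..}"
    and noise_normal: "\<And>t. t \<ge> 1 \<Longrightarrow> distributed M lborel (w t) (normal_density 0 1)"
    and P0: "P0 > 0"
    and parameter_normal: "distributed M lborel \<theta> (normal_density \<theta>0 (sqrt P0))"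
    and parameter_indep: "independent_rv M borel \<theta> (\<Pi>\<^sub>M t\<in>{1..}. borel) (noise w)"
    and initial: "admissible_initial M \<theta> w y0"
    and loop: "closed_loop M f \<theta> w (ce_law f \<theta>0 P0) y0 y"
begin

abbreviation "info \<equiv> information f P0"
abbreviation "est \<equiv> estimate f \<theta>0 P0"
abbreviation "sc \<equiv> predictive_sd f P0"

lemma y0_measurable[measurable]: "y0 \<in> borel_measurable M"
  and parameter_measurable[measurable]: "\<theta> \<in> borel_measurable M"
  using initial parameter_indep by (auto simp: admissible_initial_def independent_rv_def)

lemma noise_measurable[measurable]: "w (Suc t) \<in> borel_measurable M"
  using distributed_measurable[OF noise_normal[of "Suc t"]] by simp

text \<open>The independence assumptions are used one after the other: first \<open>y0\<close> is
  separated from parameter and noise, then the parameter from the noise, then the past noise from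
  \<open>w (Suc t)\<close>.\<close>

lemma nn_integral_independent_inputs:
  assumes H[measurable]: "H \<in> borel_measurable (borel \<Otimes>\<^sub>M borel \<Otimes>\<^sub>M (\<Pi>\<^sub>M i\<in>{1..t}. borel) \<Otimes>\<^sub>M borel)"
  shows "(\<integral>\<^sup>+\<omega>. H (y0 \<omega>, \<theta> \<omega>, (\<lambda>i\<in>{1..t}. w i \<omega>), w (Suc t) \<omega>) \<partial>M) =
    (\<integral>\<^sup>+\<omega>. (\<integral>\<^sup>+\<omega>1. (\<integral>\<^sup>+\<omega>2. (\<integral>\<^sup>+\<omega>3. H (y0 \<omega>, \<theta> \<omega>1, (\<lambda>i\<in>{1..t}. w i \<omega>2), w (Suc t) \<omega>3) \<partial>M) \<partial>M) \<partial>M) \<partial>M)"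
proof -
  define split where "split \<nu> = (restrict \<nu> {1..t}, \<nu> (Suc t))" for \<nu> :: "nat \<Rightarrow> real"
  have [measurable]: "split \<in> (\<Pi>\<^sub>M i\<in>{1..}. borel) \<rightarrow>\<^sub>M (\<Pi>\<^sub>M i\<in>{1..t}. borel) \<Otimes>\<^sub>M borel"
    unfolding split_def[abs_def] by (intro measurable_Pair measurable_restrict) auto
  have split_noise: "split (noise w \<omega>) = ((\<lambda>i\<in>{1..t}. w i \<omega>), w (Suc t) \<omega>)" for \<omega>
    by (auto simp: split_def noise_def fun_eq_iff)
  have past: "(\<lambda>\<omega>. \<lambda>i\<in>{1..t}. w i \<omega>) \<in> M \<rightarrow>\<^sub>M (\<Pi>\<^sub>M i\<in>{1..t}. borel)"
    using noise_indep by (intro measurable_restrict) (auto simp: indep_vars_def)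
  have 1: "(\<integral>\<^sup>+\<omega>. H (y0 \<omega>, \<theta> \<omega>, split (noise w \<omega>)) \<partial>M) =
      (\<integral>\<^sup>+\<omega>. (\<integral>\<^sup>+\<omega>1. H (y0 \<omega>, \<theta> \<omega>1, split (noise w \<omega>1)) \<partial>M) \<partial>M)"
    using nn_integral_indep_set[of y0 borel "\<lambda>\<omega>. (\<theta> \<omega>, noise w \<omega>)" "borel \<Otimes>\<^sub>M (\<Pi>\<^sub>M i\<in>{1..}. borel)"
        "\<lambda>x. H (fst x, fst (snd x), split (snd (snd x)))"] initial
    by (simp add: admissible_initial_def independent_rv_def del: One_nat_def)
  have 2: "(\<integral>\<^sup>+\<omega>1. H (c, \<theta> \<omega>1, split (noise w \<omega>1)) \<partial>M) =
      (\<integral>\<^sup>+\<omega>1. (\<integral>\<^sup>+\<omega>2. H (c, \<theta> \<omega>1, split (noise w \<omega>2)) \<partial>M) \<partial>M)" for c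
    using nn_integral_indep_set[of \<theta> borel "noise w" "\<Pi>\<^sub>M i\<in>{1..}. borel"
        "\<lambda>x. H (c, fst x, split (snd x))"] parameter_indep
    by (simp add: independent_rv_def del: One_nat_def)
  have 3: "(\<integral>\<^sup>+\<omega>2. H (c, z, split (noise w \<omega>2)) \<partial>M) =
      (\<integral>\<^sup>+\<omega>2. (\<integral>\<^sup>+\<omega>3. H (c, z, (\<lambda>i\<in>{1..t}. w i \<omega>2), w (Suc t) \<omega>3) \<partial>M) \<partial>M)" for c z
    using nn_integral_indep_set[OF past noise_measurable indep_vars_past_next[OF noise_indep],
        of "\<lambda>x. H (c, z, x)"]
    by (simp add: split_noise del: One_nat_def)
  show ?thesis
    using 1 unfolding 2 3 by (simp add: split_noise del: One_nat_def)
qed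

lemma nn_integral_next_noise:
  assumes H[measurable]: "H \<in> borel_measurable (borel \<Otimes>\<^sub>M borel \<Otimes>\<^sub>M (\<Pi>\<^sub>M i\<in>{1..t}. borel) \<Otimes>\<^sub>M borel)"
  shows "(\<integral>\<^sup>+\<omega>. H (y0 \<omega>, \<theta> \<omega>, (\<lambda>i\<in>{1..t}. w i \<omega>), w (Suc t) \<omega>) \<partial>M) =
    (\<integral>\<^sup>+\<omega>. (\<integral>\<^sup>+s. ennreal (normal_density 0 1 s) * H (y0 \<omega>, \<theta> \<omega>, (\<lambda>i\<in>{1..t}. w i \<omega>), s) \<partial>lborel) \<partial>M)"
proof -
  \<comment> \<open>The last coordinate of \<open>K\<close> is a dummy. It gives \<open>K\<close>
    the type of \<open>H\<close>, so that the splitting into four integrals can be applied to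
    \<open>K\<close> in the reverse direction.\<close>
  define K where "K x = (\<integral>\<^sup>+s. ennreal (normal_density 0 1 s) * H (fst x, fst (snd x), fst (snd (snd x)), s) \<partial>lborel)"
    for x :: "real \<times> real \<times> (nat \<Rightarrow> real) \<times> real"
  have K[measurable]: "K \<in> borel_measurable (borel \<Otimes>\<^sub>M borel \<Otimes>\<^sub>M (\<Pi>\<^sub>M i\<in>{1..t}. borel) \<Otimes>\<^sub>M borel)"
    unfolding K_def[abs_def] by measurable
  have inner: "(\<integral>\<^sup>+\<omega>3. H (c, z, \<nu>, w (Suc t) \<omega>3) \<partial>M) = K (c, z, \<nu>, s)"
    if "\<nu> \<in> space (\<Pi>\<^sub>M i\<in>{1..t}. borel)" for c z \<nu> s
  proof -
    have "(\<lambda>s. H (c, z, \<nu>, s)) \<in> borel_measurable borel"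
      by (rule measurable_compose[OF _ H]) (use that in auto)
    then show ?thesis
      unfolding K_def using distributed_nn_integral[OF noise_normal[of "Suc t"], of "\<lambda>s. H (c, z, \<nu>, s)"] by simp
  qed
  have sp: "(\<lambda>i\<in>{1..t}. w i \<omega>) \<in> space (\<Pi>\<^sub>M i\<in>{1..t}. borel)" for \<omega>
    by (auto simp: space_PiM)
  have "(\<integral>\<^sup>+\<omega>. H (y0 \<omega>, \<theta> \<omega>, (\<lambda>i\<in>{1..t}. w i \<omega>), w (Suc t) \<omega>) \<partial>M) =
    (\<integral>\<^sup>+\<omega>. (\<integral>\<^sup>+\<omega>1. (\<integral>\<^sup>+\<omega>2. K (y0 \<omega>, \<theta> \<omega>1, (\<lambda>i\<in>{1..t}. w i \<omega>2), 0) \<partial>M) \<partial>M) \<partial>M)"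
    unfolding nn_integral_independent_inputs[OF H] inner[OF sp, of _ _ _ 0] ..
  \<comment> \<open>A vacuous integration over a fourth sample point is inserted; it has total mass
    1.\<close>
  also have "\<dots> = (\<integral>\<^sup>+\<omega>. (\<integral>\<^sup>+\<omega>1. (\<integral>\<^sup>+\<omega>2. (\<integral>\<^sup>+\<omega>3. K (y0 \<omega>, \<theta> \<omega>1, (\<lambda>i\<in>{1..t}. w i \<omega>2), w (Suc t) \<omega>3) \<partial>M) \<partial>M) \<partial>M) \<partial>M)"
    by (simp add: K_def emeasure_space_1)
  also have "\<dots> = (\<integral>\<^sup>+\<omega>. K (y0 \<omega>, \<theta> \<omega>, (\<lambda>i\<in>{1..t}. w i \<omega>), w (Suc t) \<omega>) \<partial>M)"
    by (rule nn_integral_independent_inputs[OF K, symmetric])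
  finally show ?thesis by (simp add: K_def)
qed

text \<open>
  The output trajectory up to time \<open>t\<close>, filled up with \<open>y0\<close>: a function of \<open>y0\<close>, \<open>\<theta>\<close> and \<open>w 1, \<dots>, w t\<close> only.
\<close>

primrec path :: "nat \<Rightarrow> 'w \<Rightarrow> nat \<Rightarrow> real" where
  "path 0 \<omega> = (\<lambda>_. y0 \<omega>)"
| "path (Suc t) \<omega> = (path t \<omega>)(Suc t := y (Suc t) \<omega>)"

lemma path_eq: "\<omega> \<in> space M \<Longrightarrow> i \<le> t \<Longrightarrow> path t \<omega> i = y i \<omega>"
  using loop by (induction t) (auto simp: closed_loop_def)

lemma output_Suc:
  assumes "\<omega> \<in> space M"
  shows "y (Suc t) \<omega> = (\<theta> \<omega> - est t (path t \<omega>)) * f (path t \<omega> t) + w (Suc t) \<omega>"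
proof -
  have "est t (\<lambda>i. y i \<omega>) = est t (path t \<omega>)"
    using assms by (intro estimate_cong) (simp add: path_eq)
  then show ?thesis
    using loop assms by (simp add: closed_loop_def ce_law_def path_eq left_diff_distrib)
qed

lemma path_eq_trajectory:
  assumes "\<omega> \<in> space M"
  shows "path t \<omega> = trajectory (ce_law f \<theta>0 P0) f (y0 \<omega>) (\<theta> \<omega>) (\<lambda>i\<in>{1..t}. w i \<omega>) t"
proof -
  have "path t \<omega> = trajectory (ce_law f \<theta>0 P0) f (y0 \<omega>) (\<theta> \<omega>) (\<lambda>i. w i \<omega>) t"
    by (induction t) (simp_all add: output_Suc[OF assms] ce_law_def left_diff_distrib)
  also have "\<dots> = trajectory (ce_law f \<theta>0 P0) f (y0 \<omega>) (\<theta> \<omega>) (\<lambda>i\<in>{1..t}. w i \<omega>) t"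
    by (rule trajectory_cong) simp
  finally show ?thesis .
qed

text \<open>The outputs are given only pointwise, through the loop equation. Their measurability
  comes from the representation by the functional \<open>trajectory\<close>.\<close>

lemma path_measurable[measurable]: "path t \<in> M \<rightarrow>\<^sub>M paths"
proof -
  have past: "(\<lambda>\<omega>. \<lambda>i\<in>{1..t}. w i \<omega>) \<in> M \<rightarrow>\<^sub>M (\<Pi>\<^sub>M i\<in>{1..t}. borel)"
    using noise_indep by (intro measurable_restrict) (auto simp: indep_vars_def)
  from past have "(\<lambda>\<omega>. (y0 \<omega>, \<theta> \<omega>, (\<lambda>i\<in>{1..t}. w i \<omega>))) \<in> M \<rightarrow>\<^sub>M borel \<Otimes>\<^sub>M borel \<Otimes>\<^sub>M (\<Pi>\<^sub>M i\<in>{1..t}. borel)"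
    by measurable
  from measurable_compose[OF this measurable_trajectory[OF f_measurable measurable_ce_law[OF f_measurable] order_refl]]
  have "(\<lambda>\<omega>. trajectory (ce_law f \<theta>0 P0) f (y0 \<omega>) (\<theta> \<omega>) (\<lambda>i\<in>{1..t}. w i \<omega>) t) \<in> M \<rightarrow>\<^sub>M paths"
    unfolding fst_conv snd_conv .
  then show ?thesis
    by (subst measurable_cong[OF path_eq_trajectory]) simp_all
qed

text \<open>Since the path up to time \<open>t\<close> is a function of \<open>y0\<close>,
  \<open>\<theta>\<close> and the past noise, the next noise is standard normal conditionally on
  \<open>\<theta>\<close> and that path.\<close>

lemma nn_integral_innovation:
  assumes h[measurable]: "h \<in> borel_measurable (borel \<Otimes>\<^sub>M paths \<Otimes>\<^sub>M borel)"
  shows "(\<integral>\<^sup>+\<omega>. h (\<theta> \<omega>, path t \<omega>, w (Suc t) \<omega>) \<partial>M) =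
    (\<integral>\<^sup>+\<omega>. (\<integral>\<^sup>+s. ennreal (normal_density 0 1 s) * h (\<theta> \<omega>, path t \<omega>, s) \<partial>lborel) \<partial>M)"
proof -
  let ?tr = "\<lambda>c z \<nu>. trajectory (ce_law f \<theta>0 P0) f c z \<nu> t"
  have tr: "(\<lambda>x. ?tr (fst x) (fst (snd x)) (snd (snd x))) \<in> borel \<Otimes>\<^sub>M borel \<Otimes>\<^sub>M (\<Pi>\<^sub>M i\<in>{1..t}. borel) \<rightarrow>\<^sub>M paths"
    by (rule measurable_trajectory) (auto intro: measurable_ce_law)
  have "(\<lambda>x. (fst x, fst (snd x), fst (snd (snd x)))) \<in> borel \<Otimes>\<^sub>M borel \<Otimes>\<^sub>M (\<Pi>\<^sub>M i\<in>{1..t}. borel) \<Otimes>\<^sub>M borel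
      \<rightarrow>\<^sub>M borel \<Otimes>\<^sub>M borel \<Otimes>\<^sub>M (\<Pi>\<^sub>M i\<in>{1..t}. borel)"
    by (intro measurable_Pair measurable_fst measurable_compose[OF measurable_snd])
  from measurable_compose[OF this tr]
  have tr2: "(\<lambda>x. ?tr (fst x) (fst (snd x)) (fst (snd (snd x))))
      \<in> borel \<Otimes>\<^sub>M borel \<Otimes>\<^sub>M (\<Pi>\<^sub>M i\<in>{1..t}. borel) \<Otimes>\<^sub>M borel \<rightarrow>\<^sub>M paths"
    unfolding fst_conv snd_conv .
  have "(\<lambda>x. h (fst (snd x), ?tr (fst x) (fst (snd x)) (fst (snd (snd x))), snd (snd (snd x))))
      \<in> borel_measurable (borel \<Otimes>\<^sub>M borel \<Otimes>\<^sub>M (\<Pi>\<^sub>M i\<in>{1..t}. borel) \<Otimes>\<^sub>M borel)"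
    by (intro measurable_compose[OF _ h] measurable_Pair tr2) simp_all
  note eq = nn_integral_next_noise[OF this, unfolded fst_conv snd_conv]
  have "(\<integral>\<^sup>+\<omega>. h (\<theta> \<omega>, path t \<omega>, w (Suc t) \<omega>) \<partial>M) =
      (\<integral>\<^sup>+\<omega>. h (\<theta> \<omega>, ?tr (y0 \<omega>) (\<theta> \<omega>) (\<lambda>i\<in>{1..t}. w i \<omega>), w (Suc t) \<omega>) \<partial>M)"
    by (intro nn_integral_cong) (simp only: path_eq_trajectory)
  also note eq
  also have "(\<integral>\<^sup>+\<omega>. (\<integral>\<^sup>+s. ennreal (normal_density 0 1 s) *
        h (\<theta> \<omega>, ?tr (y0 \<omega>) (\<theta> \<omega>) (\<lambda>i\<in>{1..t}. w i \<omega>), s) \<partial>lborel) \<partial>M) =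
      (\<integral>\<^sup>+\<omega>. (\<integral>\<^sup>+s. ennreal (normal_density 0 1 s) * h (\<theta> \<omega>, path t \<omega>, s) \<partial>lborel) \<partial>M)"
    by (intro nn_integral_cong) (simp only: path_eq_trajectory)
  finally show ?thesis .
qed

end

section \<open>Posterior of the parameter and prediction of the output\<close>

lemma measurable_path_update[measurable (raw)]:
  assumes "g \<in> N \<rightarrow>\<^sub>M paths" "s \<in> borel_measurable N"
  shows "(\<lambda>x. (g x)(t := s x)) \<in> N \<rightarrow>\<^sub>M paths"
  by (rule measurable_fun_upd[where J=UNIV]) (use assms in auto)

lemma information_update[simp]: "information f P0 (Suc t) (p(Suc t := s)) = information f P0 (Suc t) p"
  by (rule information_cong) simp

lemma estimate_update:
  "estimate f \<theta>0 P0 (Suc t) (p(Suc t := s)) = estimate f \<theta>0 P0 t p + f (p t) * s / information f P0 (Suc t) p"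
proof -
  have "estimate f \<theta>0 P0 t (p(Suc t := s)) = estimate f \<theta>0 P0 t p"
    by (rule estimate_cong) simp
  moreover have "estimate f \<theta>0 P0 (Suc t) (p(Suc t := s)) =
      estimate f \<theta>0 P0 t (p(Suc t := s)) + f (p t) * s / information f P0 (Suc t) (p(Suc t := s))"
    by (simp add: estimate_def)
  ultimately show ?thesis by simp
qed

lemma measurable_normal_density_parameters[measurable (raw)]:
  assumes [measurable]: "m \<in> borel_measurable N" "v \<in> borel_measurable N" "z \<in> borel_measurable N"
  shows "(\<lambda>x. normal_density (m x) (v x) (z x)) \<in> borel_measurable N"
  unfolding normal_density_def by measurable

context certainty_equivalence
begin

definition posterior :: "nat \<Rightarrow> (nat \<Rightarrow> real) \<Rightarrow> real \<Rightarrow> real" where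
  "posterior t p = normal_density (est t p) (1 / sqrt (info t p))"

text \<open>The conditional expectation of \<open>k (\<theta>, path (Suc t))\<close> given the path
  up to \<open>t\<close>, disintegrated in filter order: first the next output under its predictive
  law, then the parameter under the updated posterior.\<close>

definition prior_predictive :: "nat \<Rightarrow> (real \<times> (nat \<Rightarrow> real) \<Rightarrow> ennreal) \<Rightarrow> (nat \<Rightarrow> real) \<Rightarrow> ennreal" where
  "prior_predictive t k p = (\<integral>\<^sup>+s. ennreal (normal_density 0 (sc t p) s) *
     (\<integral>\<^sup>+z. ennreal (posterior (Suc t) (p(Suc t := s)) z) * k (z, p(Suc t := s)) \<partial>lborel) \<partial>lborel)"

lemma measurable_posterior[measurable (raw)]:
  assumes [measurable]: "p \<in> N \<rightarrow>\<^sub>M paths" "z \<in> borel_measurable N"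
  shows "(\<lambda>x. posterior t (p x) (z x)) \<in> borel_measurable N"
  unfolding posterior_def by measurable

lemma posterior_borel[measurable]: "posterior t p \<in> borel_measurable borel"
  unfolding posterior_def by simp

lemma nn_integral_posterior: "(\<integral>\<^sup>+z. ennreal (posterior t p z) \<partial>lborel) = 1"
  unfolding posterior_def using information_pos[OF P0, of f t p] by (intro nn_integral_normal_density) simp

lemma posterior_update:
  "normal_density 0 1 (s - (z - est t p) * f (p t)) * posterior t p z =
    normal_density 0 (sc t p) s * posterior (Suc t) (p(Suc t := s)) z"
  using normal_density_posterior[OF information_pos[OF P0, of f t p], of s z "est t p" "f (p t)"]
  unfolding posterior_def estimate_update predictive_sd_def information_update information_Suc[symmetric] .

text \<open>One step of the filter. If \<open>posterior t\<close> is the conditional density of the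
  parameter at time \<open>t\<close>, then Tonelli and the Bayes identity
  \<open>posterior_update\<close> exchange the order parameter, output for the order output,
  parameter. The premise serves as induction hypothesis below.\<close>

lemma nn_integral_one_step:
  assumes posterior: "\<And>h. h \<in> borel_measurable (borel \<Otimes>\<^sub>M paths) \<Longrightarrow> (\<integral>\<^sup>+\<omega>. h (\<theta> \<omega>, path t \<omega>) \<partial>M) =
      (\<integral>\<^sup>+\<omega>. (\<integral>\<^sup>+z. ennreal (posterior t (path t \<omega>) z) * h (z, path t \<omega>) \<partial>lborel) \<partial>M)"
    and k[measurable]: "k \<in> borel_measurable (borel \<Otimes>\<^sub>M paths)"
  shows "(\<integral>\<^sup>+\<omega>. k (\<theta> \<omega>, path (Suc t) \<omega>) \<partial>M) = (\<integral>\<^sup>+\<omega>. prior_predictive t k (path t \<omega>) \<partial>M)"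
proof -
  define e where "e z p = (z - est t p) * f (p t)" for z p
  have [measurable]: "(\<lambda>x. e (z x) (p x)) \<in> borel_measurable N"
    if [measurable]: "z \<in> borel_measurable N" "p \<in> N \<rightarrow>\<^sub>M paths" for z p and N :: "'c measure"
    unfolding e_def by measurable
  have slice: "(\<lambda>x. k (z x, p(Suc t := s x))) \<in> borel_measurable N"
    if "z \<in> borel_measurable N" "s \<in> borel_measurable N" for z s p and N :: "'c measure"
    by (intro measurable_compose[OF _ k] measurable_Pair measurable_path_update measurable_const that)
       (simp add: space_PiM)
  have "(\<integral>\<^sup>+\<omega>. k (\<theta> \<omega>, path (Suc t) \<omega>) \<partial>M) =
      (\<integral>\<^sup>+\<omega>. k (\<theta> \<omega>, (path t \<omega>)(Suc t := e (\<theta> \<omega>) (path t \<omega>) + w (Suc t) \<omega>)) \<partial>M)"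
    by (intro nn_integral_cong) (simp add: output_Suc e_def)
  also have "\<dots> = (\<integral>\<^sup>+\<omega>. (\<integral>\<^sup>+s. ennreal (normal_density 0 1 s) *
      k (\<theta> \<omega>, (path t \<omega>)(Suc t := e (\<theta> \<omega>) (path t \<omega>) + s)) \<partial>lborel) \<partial>M)"
    using nn_integral_innovation[where t = t and
        h = "\<lambda>x. k (fst x, (fst (snd x))(Suc t := e (fst x) (fst (snd x)) + snd (snd x)))"]
    by simp
  \<comment> \<open>The integration variable is shifted from the noise to the next output, which
    turns the noise density into the likelihood of that output.\<close>
  also have "\<dots> = (\<integral>\<^sup>+\<omega>. (\<integral>\<^sup>+s. ennreal (normal_density 0 1 (s - e (\<theta> \<omega>) (path t \<omega>))) *
      k (\<theta> \<omega>, (path t \<omega>)(Suc t := s)) \<partial>lborel) \<partial>M)"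
  proof (rule nn_integral_cong)
    fix \<omega>
    have "(\<lambda>s. ennreal (normal_density 0 1 (s - e (\<theta> \<omega>) (path t \<omega>))) * k (\<theta> \<omega>, (path t \<omega>)(Suc t := s)))
        \<in> borel_measurable borel"
      by (intro borel_measurable_times_ennreal slice) simp_all
    from nn_integral_real_affine[OF this, of 1 "e (\<theta> \<omega>) (path t \<omega>)"]
    show "(\<integral>\<^sup>+s. ennreal (normal_density 0 1 s) *
        k (\<theta> \<omega>, (path t \<omega>)(Suc t := e (\<theta> \<omega>) (path t \<omega>) + s)) \<partial>lborel) =
      (\<integral>\<^sup>+s. ennreal (normal_density 0 1 (s - e (\<theta> \<omega>) (path t \<omega>))) *
        k (\<theta> \<omega>, (path t \<omega>)(Suc t := s)) \<partial>lborel)"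
      by simp
  qed
  also have "\<dots> = (\<integral>\<^sup>+\<omega>. (\<integral>\<^sup>+z. ennreal (posterior t (path t \<omega>) z) *
      (\<integral>\<^sup>+s. ennreal (normal_density 0 1 (s - e z (path t \<omega>))) * k (z, (path t \<omega>)(Suc t := s)) \<partial>lborel) \<partial>lborel) \<partial>M)"
    using posterior[of "\<lambda>x. \<integral>\<^sup>+s. ennreal (normal_density 0 1 (s - e (fst x) (snd x))) * k (fst x, (snd x)(Suc t := s)) \<partial>lborel"]
    by simp
  also have "\<dots> = (\<integral>\<^sup>+\<omega>. prior_predictive t k (path t \<omega>) \<partial>M)"
  proof (intro nn_integral_cong)
    fix \<omega> assume "\<omega> \<in> space M"
    define p where "p = path t \<omega>"
    have [measurable]: "(\<lambda>x. k (z x, p(Suc t := s x))) \<in> borel_measurable N"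
      if "z \<in> borel_measurable N" "s \<in> borel_measurable N" for z s and N :: "'c measure"
      using that by (rule slice)
    have [measurable]: "(\<lambda>x. e (z x) p) \<in> borel_measurable N" "(\<lambda>x. posterior t p (z x)) \<in> borel_measurable N"
      if [measurable]: "z \<in> borel_measurable N" for z and N :: "'c measure"
      unfolding e_def posterior_def by measurable
    have "(\<integral>\<^sup>+z. ennreal (posterior t p z) *
        (\<integral>\<^sup>+s. ennreal (normal_density 0 1 (s - e z p)) * k (z, p(Suc t := s)) \<partial>lborel) \<partial>lborel) =
      (\<integral>\<^sup>+z. (\<integral>\<^sup>+s. ennreal (posterior t p z) *
        (ennreal (normal_density 0 1 (s - e z p)) * k (z, p(Suc t := s))) \<partial>lborel) \<partial>lborel)"
      by (intro nn_integral_cong nn_integral_cmult[symmetric]) simp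
    also have "\<dots> = (\<integral>\<^sup>+s. (\<integral>\<^sup>+z. ennreal (posterior t p z) *
        (ennreal (normal_density 0 1 (s - e z p)) * k (z, p(Suc t := s))) \<partial>lborel) \<partial>lborel)"
      by (rule lborel_pair.Fubini') simp
    also have "\<dots> = (\<integral>\<^sup>+s. (\<integral>\<^sup>+z. ennreal (normal_density 0 (sc t p) s) *
        (ennreal (posterior (Suc t) (p(Suc t := s)) z) * k (z, p(Suc t := s))) \<partial>lborel) \<partial>lborel)"
    proof (intro nn_integral_cong)
      fix s z
      have "ennreal (posterior t p z) * ennreal (normal_density 0 1 (s - e z p)) =
          ennreal (normal_density 0 (sc t p) s) * ennreal (posterior (Suc t) (p(Suc t := s)) z)"
        using posterior_update[of s z t p]
        by (simp add: e_def ennreal_mult'[symmetric] mult.commute posterior_def)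
      then show "ennreal (posterior t p z) * (ennreal (normal_density 0 1 (s - e z p)) * k (z, p(Suc t := s))) =
          ennreal (normal_density 0 (sc t p) s) * (ennreal (posterior (Suc t) (p(Suc t := s)) z) * k (z, p(Suc t := s)))"
        by (simp add: mult.assoc[symmetric])
    qed
    also have "\<dots> = prior_predictive t k p"
      unfolding prior_predictive_def by (intro nn_integral_cong nn_integral_cmult) simp
    finally show "(\<integral>\<^sup>+z. ennreal (posterior t (path t \<omega>) z) *
        (\<integral>\<^sup>+s. ennreal (normal_density 0 1 (s - e z (path t \<omega>))) * k (z, (path t \<omega>)(Suc t := s)) \<partial>lborel) \<partial>lborel) =
      prior_predictive t k (path t \<omega>)" by (simp add: p_def)
  qed
  finally show ?thesis .
qed

text \<open>This identifies \<open>posterior t\<close> as the conditional density of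
  \<open>\<theta>\<close> given the path. In the induction step \<open>h\<close> and its posterior
  mean have the same \<open>prior_predictive\<close>, so the one-step formula applied to both gives
  the same integral.\<close>

lemma nn_integral_parameter:
  assumes "h \<in> borel_measurable (borel \<Otimes>\<^sub>M paths)"
  shows "(\<integral>\<^sup>+\<omega>. h (\<theta> \<omega>, path t \<omega>) \<partial>M) =
      (\<integral>\<^sup>+\<omega>. (\<integral>\<^sup>+z. ennreal (posterior t (path t \<omega>) z) * h (z, path t \<omega>) \<partial>lborel) \<partial>M)"
  using assms
proof (induction t arbitrary: h)
  case 0
  note h[measurable] = this
  have const: "(\<lambda>x i. g x) \<in> N \<rightarrow>\<^sub>M paths" if "g \<in> borel_measurable N" for g and N :: "'c measure"
    by (rule measurable_PiM_single') (use that in auto)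
  have h': "(\<lambda>x. h (fst (snd x), \<lambda>_. fst x)) \<in> borel_measurable (borel \<Otimes>\<^sub>M borel \<Otimes>\<^sub>M (\<Pi>\<^sub>M i\<in>{1..}. borel))"
    by (rule measurable_compose[OF _ h], rule measurable_Pair) (simp, rule const, simp)
  have "(\<integral>\<^sup>+\<omega>. h (\<theta> \<omega>, \<lambda>_. y0 \<omega>) \<partial>M) = (\<integral>\<^sup>+\<omega>. (\<integral>\<^sup>+\<omega>1. h (\<theta> \<omega>1, \<lambda>_. y0 \<omega>) \<partial>M) \<partial>M)"
    using nn_integral_indep_set[OF _ _ _ h', of y0 "\<lambda>\<omega>. (\<theta> \<omega>, noise w \<omega>)"] initial
    unfolding admissible_initial_def independent_rv_def fst_conv snd_conv by blast
  also have "\<dots> = (\<integral>\<^sup>+\<omega>. (\<integral>\<^sup>+z. ennreal (normal_density \<theta>0 (sqrt P0) z) * h (z, \<lambda>_. y0 \<omega>) \<partial>lborel) \<partial>M)"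
  proof (rule nn_integral_cong)
    fix \<omega>
    have "(\<lambda>z. h (z, \<lambda>_. y0 \<omega>)) \<in> borel_measurable borel"
      by (rule measurable_compose[OF _ h], rule measurable_Pair) (simp, rule const, simp)
    then show "(\<integral>\<^sup>+\<omega>1. h (\<theta> \<omega>1, \<lambda>_. y0 \<omega>) \<partial>M) =
        (\<integral>\<^sup>+z. ennreal (normal_density \<theta>0 (sqrt P0) z) * h (z, \<lambda>_. y0 \<omega>) \<partial>lborel)"
      by (subst distributed_nn_integral[OF parameter_normal]) simp_all
  qed
  finally show ?case
    using P0 by (simp add: posterior_def estimate_def information_def real_sqrt_divide)
next
  case (Suc t)
  note h[measurable] = Suc.prems
  let ?k = "\<lambda>x. \<integral>\<^sup>+z. ennreal (posterior (Suc t) (snd x) z) * h (z, snd x) \<partial>lborel"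
  have k: "?k \<in> borel_measurable (borel \<Otimes>\<^sub>M paths)"
    by measurable
  \<comment> \<open>The posterior mean does not depend on the parameter, and the posterior has total
    mass 1, so averaging it once more changes nothing.\<close>
  have "prior_predictive t h p = prior_predictive t ?k p" for p
    unfolding prior_predictive_def snd_conv
    by (subst nn_integral_multc) (simp_all add: nn_integral_posterior)
  then show ?case
    using nn_integral_one_step[OF Suc.IH h] nn_integral_one_step[OF Suc.IH k]
    by (simp del: path.simps)
qed

text \<open>Integrating out the parameter: given the path up to \<open>t\<close>, the next output is
  centred normal with standard deviation \<open>sc t\<close>. From here on the parameter no longer
  appears.\<close>

lemma nn_integral_output:
  assumes [measurable]: "H \<in> borel_measurable paths"
  shows "(\<integral>\<^sup>+\<omega>. H (path (Suc t) \<omega>) \<partial>M) =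
    (\<integral>\<^sup>+\<omega>. (\<integral>\<^sup>+s. ennreal (normal_density 0 (sc t (path t \<omega>)) s) * H ((path t \<omega>)(Suc t := s)) \<partial>lborel) \<partial>M)"
proof -
  have "prior_predictive t (\<lambda>x. H (snd x)) p =
      (\<integral>\<^sup>+s. ennreal (normal_density 0 (sc t p) s) * H (p(Suc t := s)) \<partial>lborel)" for p
    unfolding prior_predictive_def snd_conv
    by (subst nn_integral_multc) (simp_all add: nn_integral_posterior)
  then show ?thesis
    using nn_integral_one_step[OF nn_integral_parameter, of "\<lambda>x. H (snd x)" t] by simp
qed

end

section \<open>Almost sure properties of the outputs\<close>

text \<open>On \<open>{-R..R}\<close> the centred normal density is smallest at the
  endpoints.\<close>

lemma measure_normal_ge:
  assumes \<sigma>: "\<sigma> > 0" and A[measurable]: "A \<in> sets borel" and R: "A \<subseteq> {-R..R}"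
  shows "measure lborel A * (exp (- R\<^sup>2 / (2 * \<sigma>\<^sup>2)) / (sqrt (2 * pi) * \<sigma>))
    \<le> measure (density lborel (normal_density 0 \<sigma>)) A"
proof -
  interpret N: prob_space "density lborel (normal_density 0 \<sigma>)"
    by (rule prob_space_normal_density) fact
  define d where "d = exp (- R\<^sup>2 / (2 * \<sigma>\<^sup>2)) / (sqrt (2 * pi) * \<sigma>)"
  have d: "d \<ge> 0" using \<sigma> by (simp add: d_def)
  have fin: "emeasure lborel A < \<infinity>"
    by (rule emeasure_bounded_finite[OF bounded_subset[OF bounded_closed_interval R]])
  have low: "d \<le> normal_density 0 \<sigma> s" if "s \<in> A" for s
  proof -
    have "\<bar>s\<bar> \<le> \<bar>R\<bar>" using that R by force
    then have "s\<^sup>2 \<le> R\<^sup>2" by (simp add: abs_le_square_iff)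
    then show ?thesis
      using \<sigma> by (auto simp: d_def normal_density_def real_sqrt_mult divide_simps)
  qed
  have "ennreal (measure lborel A * d) = (\<integral>\<^sup>+s. ennreal d * indicator A s \<partial>lborel)"
    using fin d by (simp add: nn_integral_cmult_indicator ennreal_mult' emeasure_eq_ennreal_measure mult.commute)
  also have "\<dots> \<le> (\<integral>\<^sup>+s. ennreal (normal_density 0 \<sigma> s) * indicator A s \<partial>lborel)"
    by (intro nn_integral_mono) (auto simp: indicator_def intro!: ennreal_leI low)
  also have "\<dots> = ennreal (measure (density lborel (normal_density 0 \<sigma>)) A)"
    by (subst emeasure_density[symmetric]) (simp_all add: N.emeasure_eq_measure)
  finally show ?thesis by (simp add: d_def)
qed

text \<open>The integral equals \<open>b - (b - a) * P\<close> with \<open>P\<close> the normal mass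
  of \<open>A\<close>, which decreases in \<open>P\<close>; a lower bound for the mass therefore
  gives an upper bound. It yields the contraction factors of the exponential and hitting
  estimates.\<close>

lemma nn_integral_normal_two_levels:
  assumes \<sigma>: "\<sigma> > 0" and A[measurable]: "A \<in> sets borel" and R: "A \<subseteq> {-R..R}"
    and ab: "0 \<le> a" "a \<le> b"
    and c: "c \<le> measure lborel A * (exp (- R\<^sup>2 / (2 * \<sigma>\<^sup>2)) / (sqrt (2 * pi) * \<sigma>))"
  shows "(\<integral>\<^sup>+s. ennreal (normal_density 0 \<sigma> s) * ennreal (if s \<in> A then a else b) \<partial>lborel) \<le> ennreal (b - (b - a) * c)"
proof -
  let ?N = "density lborel (normal_density 0 \<sigma>)"
  interpret N: prob_space ?N
    by (rule prob_space_normal_density) fact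
  have m: "c \<le> N.prob A"
    using measure_normal_ge[OF \<sigma> A R] c by linarith
  have "(\<integral>\<^sup>+s. ennreal (normal_density 0 \<sigma> s) * ennreal (if s \<in> A then a else b) \<partial>lborel) =
      (\<integral>\<^sup>+s. ennreal (if s \<in> A then a else b) \<partial>?N)"
    by (subst nn_integral_density) simp_all
  also have "\<dots> = (\<integral>\<^sup>+s. ennreal a * indicator A s + ennreal b * indicator (- A) s \<partial>?N)"
    by (intro nn_integral_cong) (auto simp: indicator_def)
  also have "\<dots> = ennreal a * emeasure ?N A + ennreal b * emeasure ?N (- A)"
    by (subst nn_integral_add) (simp_all add: nn_integral_cmult_indicator)
  also have "\<dots> = ennreal (a * N.prob A + b * (1 - N.prob A))"
  proof -
    have "N.prob (- A) = 1 - N.prob A"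
      using N.prob_compl[of A] A by (simp add: Compl_eq_Diff_UNIV)
    then show ?thesis
      using ab by (simp add: N.emeasure_eq_measure ennreal_mult'[symmetric] ennreal_plus[symmetric] del: ennreal_plus)
  qed
  also have "\<dots> \<le> ennreal (b - (b - a) * c)"
    using mult_left_mono[OF m, of "b - a"] ab by (intro ennreal_leI) (simp add: algebra_simps)
  finally show ?thesis .
qed

text \<open>The weight turns the density of variance \<open>\<sigma>\<^sup>2\<close> into
  \<open>sqrt 2\<close> times the density of variance \<open>2 * \<sigma>\<^sup>2\<close>.\<close>

lemma nn_integral_normal_exp_square:
  assumes "\<sigma> > 0"
  shows "(\<integral>\<^sup>+s. ennreal (normal_density 0 \<sigma> s) * ennreal (exp ((s / \<sigma>)\<^sup>2 / 4)) \<partial>lborel) = ennreal (sqrt 2)"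
proof -
  have "normal_density 0 \<sigma> s * exp ((s / \<sigma>)\<^sup>2 / 4) = sqrt 2 * normal_density 0 (sqrt 2 * \<sigma>) s" for s
  proof -
    have "exp (- s\<^sup>2 / (2 * \<sigma>\<^sup>2)) * exp ((s / \<sigma>)\<^sup>2 / 4) = exp (- s\<^sup>2 / (2 * (sqrt 2 * \<sigma>)\<^sup>2))"
      using assms by (simp add: exp_add[symmetric] power_divide power_mult_distrib field_simps)
    moreover have "sqrt (2 * pi * (sqrt 2 * \<sigma>)\<^sup>2) = sqrt 2 * sqrt (2 * pi * \<sigma>\<^sup>2)"
      by (simp add: power_mult_distrib real_sqrt_mult)
    ultimately show ?thesis
      using assms by (simp add: normal_density_def)
  qed
  then have "(\<integral>\<^sup>+s. ennreal (normal_density 0 \<sigma> s) * ennreal (exp ((s / \<sigma>)\<^sup>2 / 4)) \<partial>lborel) =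
      (\<integral>\<^sup>+s. ennreal (sqrt 2) * ennreal (normal_density 0 (sqrt 2 * \<sigma>) s) \<partial>lborel)"
    by (simp add: ennreal_mult'[symmetric])
  also have "\<dots> = ennreal (sqrt 2)"
    using assms by (subst nn_integral_cmult) (simp_all add: nn_integral_normal_density)
  finally show ?thesis .
qed

text \<open>Markov's inequality followed by Borel-Cantelli. The asymptotic bounds on innovations and
  information below arise by choosing \<open>V\<close> as an exponential functional.\<close>

lemma (in prob_space) AE_eventually_less_1:
  fixes V :: "nat \<Rightarrow> 'a \<Rightarrow> ennreal"
  assumes V[measurable]: "\<And>n. V n \<in> borel_measurable M"
    and bound: "\<And>n. (\<integral>\<^sup>+\<omega>. V n \<omega> \<partial>M) \<le> ennreal (c n)" and c: "\<And>n. c n \<ge> 0" "summable c"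
  shows "AE \<omega> in M. \<forall>\<^sub>F n in sequentially. V n \<omega> < 1"
proof -
  define B where "B n = {\<omega> \<in> space M. 1 \<le> V n \<omega>}" for n
  have [measurable]: "B n \<in> sets M" for n
    unfolding B_def by measurable
  have "prob (B n) \<le> c n" for n
  proof -
    have "emeasure M (B n) \<le> (\<integral>\<^sup>+\<omega>. V n \<omega> \<partial>M)"
      using nn_integral_Markov_inequality[of "V n" "space M" M 1] by (simp add: B_def nn_set_integral_space)
    also have "\<dots> \<le> ennreal (c n)" by fact
    finally show ?thesis by (simp add: emeasure_eq_measure c)
  qed
  then have "summable (\<lambda>n. prob (B n))"
    by (intro summable_comparison_test'[OF c(2), of 0]) simp
  then have "AE \<omega> in M. \<forall>\<^sub>F n in sequentially. \<omega> \<in> space M - B n"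
    by (intro borel_cantelli_AE1) (auto simp: less_top[symmetric])
  then show ?thesis
    by (rule AE_mp) (auto simp: B_def not_le elim!: eventually_mono)
qed

section \<open>Exponential moments of the innovations\<close>

context certainty_equivalence
begin

declare path.simps[simp del]

abbreviation outputs :: "'w \<Rightarrow> nat \<Rightarrow> real" where
  "outputs \<omega> \<equiv> (\<lambda>i. y i \<omega>)"

lemma sc_pos: "sc t p > 0"
  using predictive_sd_ge_1[OF P0, of f t p] by linarith

lemma output_measurable[measurable]: "y t \<in> borel_measurable M"
proof -
  have "(\<lambda>\<omega>. path t \<omega> t) \<in> borel_measurable M" by measurable
  then show ?thesis
    by (subst measurable_cong[of _ _ "\<lambda>\<omega>. path t \<omega> t"]) (simp_all add: path_eq)
qed

text \<open>A conditional bound that holds for every past path integrates to an unconditional one.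
  Iterated, it replaces martingale arguments.\<close>

lemma nn_integral_output_le:
  assumes [measurable]: "H \<in> borel_measurable paths"
    and le: "\<And>p. (\<integral>\<^sup>+s. ennreal (normal_density 0 (sc t p) s) * H (p(Suc t := s)) \<partial>lborel) \<le> V p"
  shows "(\<integral>\<^sup>+\<omega>. H (path (Suc t) \<omega>) \<partial>M) \<le> (\<integral>\<^sup>+\<omega>. V (path t \<omega>) \<partial>M)"
  unfolding nn_integral_output[OF assms(1)] by (intro nn_integral_mono le)

definition innovation :: "nat \<Rightarrow> (nat \<Rightarrow> real) \<Rightarrow> real" where
  "innovation t p = p (Suc t) / sc t p"

lemma measurable_innovation[measurable]: "innovation t \<in> borel_measurable paths"
  unfolding innovation_def[abs_def] by measurable

lemma innovation_cong: "(\<And>i. i \<le> Suc t \<Longrightarrow> p i = q i) \<Longrightarrow> innovation t p = innovation t q"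
  unfolding innovation_def by (intro arg_cong2[where f="(/)"] predictive_sd_cong) auto

lemma predictive_sd_update: "sc t (p(Suc t := s)) = sc t p"
  by (rule predictive_sd_cong) simp

lemma nn_integral_exp_innovation:
  "(\<integral>\<^sup>+s. ennreal (normal_density 0 (sc t p) s) * ennreal (exp ((innovation t (p(Suc t := s)))\<^sup>2 / 4)) \<partial>lborel) = ennreal (sqrt 2)"
  using nn_integral_normal_exp_square[OF sc_pos[of t p]] by (simp add: innovation_def predictive_sd_update)

text \<open>The exponential moment is always \<open>sqrt 2\<close>, so the weight
  \<open>1 / (real (Suc n))\<^sup>2\<close> makes the means summable. The event \<open>V < 1\<close>
  then says that a quarter of the squared innovation is below \<open>2 * ln (real (Suc n))\<close>,
  whence the constant 8.\<close>

lemma AE_innovation_log: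
  "AE \<omega> in M. \<forall>\<^sub>F n in sequentially. (innovation n (outputs \<omega>))\<^sup>2 \<le> 8 * ln (real (Suc n))"
proof -
  define V where "V n p = ennreal (exp ((innovation n p)\<^sup>2 / 4)) * ennreal (1 / (real (Suc n))\<^sup>2)" for n p
  have [measurable]: "V n \<in> borel_measurable paths" for n
    unfolding V_def[abs_def] by measurable
  have V: "(\<integral>\<^sup>+s. ennreal (normal_density 0 (sc n p) s) * V n (p(Suc n := s)) \<partial>lborel)
      \<le> ennreal (sqrt 2 * (1 / (real (Suc n))\<^sup>2))" for n p
  proof -
    have "(\<integral>\<^sup>+s. ennreal (normal_density 0 (sc n p) s) * V n (p(Suc n := s)) \<partial>lborel) =
       (\<integral>\<^sup>+s. (ennreal (normal_density 0 (sc n p) s) * ennreal (exp ((innovation n (p(Suc n := s)))\<^sup>2 / 4))) *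
          ennreal (1 / (real (Suc n))\<^sup>2) \<partial>lborel)"
      by (simp add: V_def mult.assoc)
    also have "\<dots> = (\<integral>\<^sup>+s. ennreal (normal_density 0 (sc n p) s) *
        ennreal (exp ((innovation n (p(Suc n := s)))\<^sup>2 / 4)) \<partial>lborel) * ennreal (1 / (real (Suc n))\<^sup>2)"
      by (rule nn_integral_multc) (simp add: innovation_def predictive_sd_update)
    also have "\<dots> = ennreal (sqrt 2 * (1 / (real (Suc n))\<^sup>2))"
      by (simp only: nn_integral_exp_innovation) (simp add: ennreal_mult'[symmetric])
    finally show ?thesis by simp
  qed
  have E: "(\<integral>\<^sup>+\<omega>. V n (path (Suc n) \<omega>) \<partial>M) \<le> ennreal (sqrt 2 * (1 / (real (Suc n))\<^sup>2))" for n
    using nn_integral_output_le[OF _ V] by (simp add: emeasure_space_1)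
  have "summable (\<lambda>n. 1 / (real (Suc n))\<^sup>2)"
    using inverse_power_summable[of 2, where 'a=real] by (subst summable_Suc_iff) (simp add: divide_inverse)
  then have "summable (\<lambda>n. sqrt 2 * (1 / (real (Suc n))\<^sup>2))"
    by (rule summable_mult)
  then have "AE \<omega> in M. \<forall>\<^sub>F n in sequentially. V n (path (Suc n) \<omega>) < 1"
    by (intro AE_eventually_less_1[OF _ E]) auto
  then show ?thesis
  proof (rule AE_mp, intro AE_I2 impI)
    fix \<omega> assume \<omega>: "\<omega> \<in> space M" and "\<forall>\<^sub>F n in sequentially. V n (path (Suc n) \<omega>) < 1"
    then show "\<forall>\<^sub>F n in sequentially. (innovation n (outputs \<omega>))\<^sup>2 \<le> 8 * ln (real (Suc n))"
    proof (elim eventually_mono)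
      fix n assume n: "V n (path (Suc n) \<omega>) < 1"
      have eq: "innovation n (path (Suc n) \<omega>) = innovation n (outputs \<omega>)"
        using \<omega> by (intro innovation_cong) (simp add: path_eq del: path.simps)
      have "ennreal (exp ((innovation n (outputs \<omega>))\<^sup>2 / 4) * (1 / (real (Suc n))\<^sup>2)) < ennreal 1"
        using n by (simp add: V_def eq ennreal_mult'[symmetric] del: path.simps)
      then have "exp ((innovation n (outputs \<omega>))\<^sup>2 / 4) < (real (Suc n))\<^sup>2"
        by (subst (asm) ennreal_less_iff) (auto simp: divide_simps split: if_splits)
      then have "(innovation n (outputs \<omega>))\<^sup>2 / 4 < ln ((real (Suc n))\<^sup>2)"
        by (metis exp_gt_zero exp_ln ln_less_cancel_iff ln_exp order_less_trans)
      then show "(innovation n (outputs \<omega>))\<^sup>2 \<le> 8 * ln (real (Suc n))"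
        by (simp add: ln_realpow)
    qed
  qed
qed

text \<open>A Chernoff bound: each step multiplies the mean of \<open>V\<close> by
  \<open>sqrt 2 * exp (- 1) < 1\<close>, so the means decay geometrically, and \<open>V < 1\<close>
  is the stated bound on the sum.\<close>

lemma AE_innovation_sum:
  "AE \<omega> in M. \<forall>\<^sub>F n in sequentially. (\<Sum>i<n. (innovation i (outputs \<omega>))\<^sup>2) \<le> 4 * real n"
proof -
  define V where "V n p = ennreal (exp ((\<Sum>i<n. (innovation i p)\<^sup>2) / 4 - real n))" for n p
  have [measurable]: "V n \<in> borel_measurable paths" for n
    unfolding V_def[abs_def] by measurable
  have V: "(\<integral>\<^sup>+s. ennreal (normal_density 0 (sc n p) s) * V (Suc n) (p(Suc n := s)) \<partial>lborel)
      \<le> ennreal (sqrt 2 * exp (- 1)) * V n p" for n p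
  proof -
    have "V (Suc n) (p(Suc n := s)) = ennreal (exp ((innovation n (p(Suc n := s)))\<^sup>2 / 4)) * (ennreal (exp (- 1)) * V n p)" for s
    proof -
      have "(\<Sum>i<n. (innovation i (p(Suc n := s)))\<^sup>2) = (\<Sum>i<n. (innovation i p)\<^sup>2)"
        by (intro sum.cong refl arg_cong[where f="\<lambda>x. x\<^sup>2"] innovation_cong) auto
      then show ?thesis
        by (simp add: V_def ennreal_mult'[symmetric] exp_add[symmetric] add_divide_distrib)
    qed
    then have "(\<integral>\<^sup>+s. ennreal (normal_density 0 (sc n p) s) * V (Suc n) (p(Suc n := s)) \<partial>lborel) =
       (\<integral>\<^sup>+s. (ennreal (normal_density 0 (sc n p) s) * ennreal (exp ((innovation n (p(Suc n := s)))\<^sup>2 / 4))) *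
          (ennreal (exp (- 1)) * V n p) \<partial>lborel)"
      by (simp add: mult.assoc)
    also have "\<dots> = (\<integral>\<^sup>+s. ennreal (normal_density 0 (sc n p) s) *
        ennreal (exp ((innovation n (p(Suc n := s)))\<^sup>2 / 4)) \<partial>lborel) * (ennreal (exp (- 1)) * V n p)"
      by (rule nn_integral_multc) (simp add: innovation_def predictive_sd_update)
    also have "\<dots> = ennreal (sqrt 2 * exp (- 1)) * V n p"
      by (simp only: nn_integral_exp_innovation) (simp add: ennreal_mult' mult.assoc)
    finally show ?thesis by simp
  qed
  have E: "(\<integral>\<^sup>+\<omega>. V n (path n \<omega>) \<partial>M) \<le> ennreal ((sqrt 2 * exp (- 1)) ^ n)" for n
  proof (induction n)
    case 0
    then show ?case by (simp add: V_def emeasure_space_1)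
  next
    case (Suc n)
    have "(\<integral>\<^sup>+\<omega>. V (Suc n) (path (Suc n) \<omega>) \<partial>M) \<le> (\<integral>\<^sup>+\<omega>. ennreal (sqrt 2 * exp (- 1)) * V n (path n \<omega>) \<partial>M)"
      by (rule nn_integral_output_le[OF _ V]) simp
    also have "\<dots> = ennreal (sqrt 2 * exp (- 1)) * (\<integral>\<^sup>+\<omega>. V n (path n \<omega>) \<partial>M)"
      by (rule nn_integral_cmult) simp
    also have "\<dots> \<le> ennreal (sqrt 2 * exp (- 1)) * ennreal ((sqrt 2 * exp (- 1)) ^ n)"
      by (intro mult_left_mono Suc.IH) simp
    finally show ?case by (simp add: ennreal_mult'[symmetric])
  qed
  have "sqrt 2 * exp (- 1 :: real) < 1"
  proof -
    have "sqrt 2 < (2::real)" using real_sqrt_less_iff[of 2 4] by simp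
    also have "2 \<le> exp (1::real)" using exp_ge_add_one_self[of 1] by simp
    finally show ?thesis by (simp add: exp_minus field_simps)
  qed
  then have "summable (\<lambda>n. (sqrt 2 * exp (- 1 :: real)) ^ n)"
    by (intro summable_geometric) simp
  then have "AE \<omega> in M. \<forall>\<^sub>F n in sequentially. V n (path n \<omega>) < 1"
    by (intro AE_eventually_less_1[OF _ E]) auto
  then show ?thesis
  proof (rule AE_mp, intro AE_I2 impI)
    fix \<omega> assume \<omega>: "\<omega> \<in> space M" and "\<forall>\<^sub>F n in sequentially. V n (path n \<omega>) < 1"
    then show "\<forall>\<^sub>F n in sequentially. (\<Sum>i<n. (innovation i (outputs \<omega>))\<^sup>2) \<le> 4 * real n"
    proof (elim eventually_mono)
      fix n assume n: "V n (path n \<omega>) < 1"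
      have "(\<Sum>i<n. (innovation i (path n \<omega>))\<^sup>2) = (\<Sum>i<n. (innovation i (outputs \<omega>))\<^sup>2)"
        using \<omega> by (intro sum.cong refl arg_cong[where f="\<lambda>x. x\<^sup>2"] innovation_cong) (simp add: path_eq)
      with n show "(\<Sum>i<n. (innovation i (outputs \<omega>))\<^sup>2) \<le> 4 * real n"
        by (simp add: V_def)
    qed
  qed
qed

end

section \<open>Information growth, null sets and hits of the sparse set\<close>

context certainty_equivalence
begin

lemma info_ge: "1 / P0 \<le> info t p"
  by (simp add: information_def sum_nonneg)

text \<open>
  In each step either the variance exceeds \<open>2\<close> and the information doubles, or the next output lies in the level
  set with probability bounded below. The sum of two consecutive information terms registers both kinds of progress.
\<close>

lemma nn_integral_exp_information_le:
  assumes \<epsilon>: "\<epsilon> > 0" and R: "R \<ge> 0"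
    and pos: "measure lborel {x. \<bar>x\<bar> \<le> R \<and> \<epsilon> \<le> (f x)\<^sup>2} > 0"
  shows "\<exists>q. 0 < q \<and> q < 1 \<and> (\<forall>t p. (\<integral>\<^sup>+s. ennreal (normal_density 0 (sc t p) s) *
    ennreal (exp (- (info (Suc t) p + info (Suc (Suc t)) (p(Suc t := s))))) \<partial>lborel) \<le>
      ennreal (q * exp (- (info t p + info (Suc t) p))))"
proof -
  define E where "E = {x. \<bar>x\<bar> \<le> R \<and> \<epsilon> \<le> (f x)\<^sup>2}"
  have E[measurable]: "E \<in> sets borel"
    unfolding E_def by measurable
  have ER: "E \<subseteq> {-R..R}"
    by (auto simp: E_def)
  \<comment> \<open>A lower bound for the chance to land in \<open>E\<close> whenever the standard
    deviation lies between 1 and \<open>sqrt 2\<close>: the exponent is worst at 1, the prefactor at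
    \<open>sqrt 2\<close>.\<close>
  define c where "c = measure lborel E * (exp (- R\<^sup>2 / 2) / (sqrt (2 * pi) * sqrt 2))"
  have c: "c > 0"
    using pos by (simp add: c_def E_def)
  \<comment> \<open>One contraction factor per case: a doubling adds at least \<open>1 / P0\<close>
    to the information, and a visit to \<open>E\<close> adds at least
    \<open>\<epsilon>\<close>.\<close>
  define q where "q = max (exp (- (1 / P0))) (1 - (1 - exp (- \<epsilon>)) * c)"
  have q: "0 < q" "q < 1"
    using P0 \<epsilon> c by (auto simp: q_def less_max_iff_disj)
  show ?thesis
  proof (intro exI[of _ q] conjI allI q)
    fix t p
    define W where "W = info t p + info (Suc t) p"
    have W: "info (Suc t) p + info (Suc (Suc t)) (p(Suc t := s)) = W + (f (p t))\<^sup>2 + (f s)\<^sup>2" for s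
      by (simp add: W_def information_Suc[of f P0 "Suc t"] information_Suc[of f P0 t p])
    show "(\<integral>\<^sup>+s. ennreal (normal_density 0 (sc t p) s) *
        ennreal (exp (- (info (Suc t) p + info (Suc (Suc t)) (p(Suc t := s))))) \<partial>lborel) \<le>
        ennreal (q * exp (- (info t p + info (Suc t) p)))"
    proof (cases "(sc t p)\<^sup>2 > 2")
      case True
      then have "info (Suc t) p > 2 * info t p"
        using information_pos[OF P0, of f t p] by (simp add: predictive_sd_power2[OF P0] field_simps)
      then have f2: "(f (p t))\<^sup>2 \<ge> 1 / P0"
        using info_ge[of t p] by (simp add: information_Suc)
      have "(\<integral>\<^sup>+s. ennreal (normal_density 0 (sc t p) s) *
          ennreal (exp (- (info (Suc t) p + info (Suc (Suc t)) (p(Suc t := s))))) \<partial>lborel) \<le>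
        (\<integral>\<^sup>+s. ennreal (normal_density 0 (sc t p) s) * ennreal (exp (- (1 / P0)) * exp (- W)) \<partial>lborel)"
      proof (intro nn_integral_mono mult_left_mono ennreal_leI)
        fix s
        have "- (W + (f (p t))\<^sup>2 + (f s)\<^sup>2) \<le> - (1 / P0) + - W"
          using f2 zero_le_power2[of "f s"] by linarith
        then show "exp (- (info (Suc t) p + info (Suc (Suc t)) (p(Suc t := s)))) \<le> exp (- (1 / P0)) * exp (- W)"
          unfolding W exp_add[symmetric] by simp
      qed simp
      also have "\<dots> = ennreal (exp (- (1 / P0)) * exp (- W))"
        by (subst nn_integral_multc) (simp_all add: nn_integral_normal_density sc_pos)
      also have "\<dots> \<le> ennreal (q * exp (- W))"
        by (intro ennreal_leI mult_right_mono) (auto simp: q_def)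
      finally show ?thesis by (simp add: W_def)
    next
      case False
      then have s2: "sc t p \<le> sqrt 2"
        using sc_pos[of t p] by (intro real_le_rsqrt) simp
      have cs: "c \<le> measure lborel E * (exp (- R\<^sup>2 / (2 * (sc t p)\<^sup>2)) / (sqrt (2 * pi) * sc t p))"
        unfolding c_def
      proof (intro mult_left_mono frac_le)
        have "1 \<le> (sc t p)\<^sup>2" using predictive_sd_ge_1[OF P0, of f t p] by simp
        then have "R\<^sup>2 / (2 * (sc t p)\<^sup>2) \<le> R\<^sup>2 / 2"
          by (intro divide_left_mono) auto
        then show "exp (- R\<^sup>2 / 2) \<le> exp (- R\<^sup>2 / (2 * (sc t p)\<^sup>2))" by simp
      qed (use s2 sc_pos[of t p] in auto)
      have "(\<integral>\<^sup>+s. ennreal (normal_density 0 (sc t p) s) *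
          ennreal (exp (- (info (Suc t) p + info (Suc (Suc t)) (p(Suc t := s))))) \<partial>lborel) \<le>
        (\<integral>\<^sup>+s. ennreal (normal_density 0 (sc t p) s) *
          ennreal (if s \<in> E then exp (- \<epsilon>) * exp (- W) else exp (- W)) \<partial>lborel)"
      proof (intro nn_integral_mono mult_left_mono ennreal_leI)
        fix s
        have "- (W + (f (p t))\<^sup>2 + (f s)\<^sup>2) \<le> - (f s)\<^sup>2 + - W"
          using zero_le_power2[of "f (p t)"] by linarith
        moreover have "s \<in> E \<Longrightarrow> \<epsilon> \<le> (f s)\<^sup>2" "0 \<le> (f s)\<^sup>2"
          by (auto simp: E_def)
        ultimately have "- (W + (f (p t))\<^sup>2 + (f s)\<^sup>2) \<le> (if s \<in> E then - \<epsilon> + - W else - W)"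
          by (smt (verit))
        then show "exp (- (info (Suc t) p + info (Suc (Suc t)) (p(Suc t := s)))) \<le>
            (if s \<in> E then exp (- \<epsilon>) * exp (- W) else exp (- W))"
          unfolding W exp_add[symmetric] by (auto split: if_splits)
      qed simp
      also have "\<dots> \<le> ennreal (exp (- W) - (exp (- W) - exp (- \<epsilon>) * exp (- W)) * c)"
        by (rule nn_integral_normal_two_levels[OF sc_pos E ER _ _ cs]) (use \<epsilon> in auto)
      also have "\<dots> \<le> ennreal (q * exp (- W))"
      proof (rule ennreal_leI)
        have "(1 - (1 - exp (- \<epsilon>)) * c) * exp (- W) \<le> q * exp (- W)"
          by (intro mult_right_mono) (auto simp: q_def)
        then show "exp (- W) - (exp (- W) - exp (- \<epsilon>) * exp (- W)) * c \<le> q * exp (- W)"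
          by (simp add: algebra_simps)
      qed
      finally show ?thesis by (simp add: W_def)
    qed
  qed
qed

text \<open>The exponential of minus two consecutive information terms has mean at most
  \<open>q ^ n\<close>. One factor \<open>sqrt q\<close> per step is spent on summability for
  Borel-Cantelli, the other one becomes the linear growth rate.\<close>

lemma AE_information_growth:
  assumes \<epsilon>: "\<epsilon> > 0" and R: "R \<ge> 0"
    and pos: "measure lborel {x. \<bar>x\<bar> \<le> R \<and> \<epsilon> \<le> (f x)\<^sup>2} > 0"
  shows "\<exists>\<kappa>>0. AE \<omega> in M. \<forall>\<^sub>F n in sequentially. \<kappa> * real n \<le> info (Suc n) (outputs \<omega>)"
proof -
  obtain q where q: "0 < q" "q < 1" and step: "\<And>t p. (\<integral>\<^sup>+s. ennreal (normal_density 0 (sc t p) s) *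
    ennreal (exp (- (info (Suc t) p + info (Suc (Suc t)) (p(Suc t := s))))) \<partial>lborel) \<le>
      ennreal (q * exp (- (info t p + info (Suc t) p)))"
    using nn_integral_exp_information_le[OF assms] by blast
  define V where "V n p = ennreal (exp (- (info n p + info (Suc n) p)))" for n p
  have [measurable]: "V n \<in> borel_measurable paths" for n
    unfolding V_def[abs_def] by measurable
  have E: "(\<integral>\<^sup>+\<omega>. V n (path n \<omega>) \<partial>M) \<le> ennreal (q ^ n)" for n
  proof (induction n)
    case 0
    have "(\<integral>\<^sup>+\<omega>. V 0 (path 0 \<omega>) \<partial>M) \<le> (\<integral>\<^sup>+\<omega>. ennreal 1 \<partial>M)"
    proof (rule nn_integral_mono)
      fix \<omega>
      have "0 < info 0 (path 0 \<omega>)" "0 < info (Suc 0) (path 0 \<omega>)"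
        by (rule information_pos[OF P0])+
      then show "V 0 (path 0 \<omega>) \<le> ennreal 1"
        unfolding V_def by (intro ennreal_leI) (simp del: One_nat_def)
    qed
    then show ?case by (simp add: emeasure_space_1)
  next
    case (Suc n)
    have "(\<integral>\<^sup>+\<omega>. V (Suc n) (path (Suc n) \<omega>) \<partial>M) \<le> (\<integral>\<^sup>+\<omega>. ennreal q * V n (path n \<omega>) \<partial>M)"
    proof (rule nn_integral_output_le)
      show "(\<integral>\<^sup>+s. ennreal (normal_density 0 (sc n p) s) * V (Suc n) (p(Suc n := s)) \<partial>lborel) \<le> ennreal q * V n p" for p
        using step[of n p] q by (simp add: V_def ennreal_mult' del: fun_upd_apply)
    qed simp
    also have "\<dots> = ennreal q * (\<integral>\<^sup>+\<omega>. V n (path n \<omega>) \<partial>M)"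
      by (rule nn_integral_cmult) simp
    also have "\<dots> \<le> ennreal q * ennreal (q ^ n)"
      by (intro mult_left_mono Suc.IH) simp
    finally show ?case using q by (simp add: ennreal_mult'[symmetric])
  qed
  define r where "r = sqrt q"
  have r: "0 < r" "r < 1" "q = r * r"
    using q by (auto simp: r_def)
  define U where "U n \<omega> = ennreal (inverse r ^ n) * V n (path n \<omega>)" for n \<omega>
  have U: "(\<integral>\<^sup>+\<omega>. U n \<omega> \<partial>M) \<le> ennreal (r ^ n)" for n
  proof -
    have "(\<integral>\<^sup>+\<omega>. U n \<omega> \<partial>M) = ennreal (inverse r ^ n) * (\<integral>\<^sup>+\<omega>. V n (path n \<omega>) \<partial>M)"
      unfolding U_def by (rule nn_integral_cmult) simp
    also have "\<dots> \<le> ennreal (inverse r ^ n) * ennreal (q ^ n)"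
      by (intro mult_left_mono E) simp
    also have "\<dots> = ennreal (r ^ n)"
      using r by (simp add: ennreal_mult'[symmetric] power_mult_distrib field_simps)
    finally show ?thesis .
  qed
  have "summable (\<lambda>n. r ^ n)"
    using r by (intro summable_geometric) simp
  then have "AE \<omega> in M. \<forall>\<^sub>F n in sequentially. U n \<omega> < 1"
    by (intro AE_eventually_less_1[OF _ U]) (use r in \<open>auto simp: U_def\<close>)
  then have "AE \<omega> in M. \<forall>\<^sub>F n in sequentially. - ln r / 2 * real n \<le> info (Suc n) (outputs \<omega>)"
  proof (rule AE_mp, intro AE_I2 impI)
    fix \<omega> assume \<omega>: "\<omega> \<in> space M" and "\<forall>\<^sub>F n in sequentially. U n \<omega> < 1"
    then show "\<forall>\<^sub>F n in sequentially. - ln r / 2 * real n \<le> info (Suc n) (outputs \<omega>)"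
    proof (elim eventually_mono)
      fix n assume n: "U n \<omega> < 1"
      have eq: "info n (path n \<omega>) = info n (outputs \<omega>)" "info (Suc n) (path n \<omega>) = info (Suc n) (outputs \<omega>)"
        using \<omega> by (auto intro!: information_cong simp: path_eq)
      have "inverse r ^ n = exp (- ln r * real n)"
        using r by (simp add: exp_of_nat2_mult exp_minus power_inverse)
      then have "U n \<omega> = ennreal (exp (- ln r * real n - (info n (outputs \<omega>) + info (Suc n) (outputs \<omega>))))"
        by (simp add: U_def V_def eq ennreal_mult'[symmetric] exp_add[symmetric])
      with n have "- ln r * real n < info n (outputs \<omega>) + info (Suc n) (outputs \<omega>)"
        by simp
      then show "- ln r / 2 * real n \<le> info (Suc n) (outputs \<omega>)"
        using information_mono[of n "Suc n" f P0 "outputs \<omega>"] by simp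
    qed
  qed
  moreover have "- ln r / 2 > 0" using r by simp
  ultimately show ?thesis by blast
qed

text \<open>Each output after time 0 has a conditional density. This settles the degenerate case in
  which \<open>f\<close> vanishes almost everywhere.\<close>

lemma AE_output_not_in_null_set:
  assumes [measurable]: "N \<in> sets borel" and N: "emeasure lborel N = 0"
  shows "AE \<omega> in M. \<forall>n. y (Suc n) \<omega> \<notin> N"
  unfolding AE_all_countable
proof
  fix n
  have "(\<integral>\<^sup>+\<omega>. indicator N (path (Suc n) \<omega> (Suc n)) \<partial>M) \<le> (\<integral>\<^sup>+\<omega>. 0 \<partial>M)"
  proof (rule nn_integral_output_le[where H = "\<lambda>p. indicator N (p (Suc n))" and V = "\<lambda>_. 0"])
    fix p
    have "AE s in lborel. s \<notin> N"
      using N by (intro AE_not_in) (auto simp: null_sets_def)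
    then have "AE s in lborel. ennreal (normal_density 0 (sc n p) s) * indicator N ((p(Suc n := s)) (Suc n)) = 0"
      by eventually_elim simp
    from nn_integral_cong_AE[OF this]
    have "(\<integral>\<^sup>+s. ennreal (normal_density 0 (sc n p) s) * indicator N ((p(Suc n := s)) (Suc n)) \<partial>lborel) =
        (\<integral>\<^sup>+s. 0 \<partial>(lborel :: real measure))" .
    then show "(\<integral>\<^sup>+s. ennreal (normal_density 0 (sc n p) s) * indicator N ((p(Suc n := s)) (Suc n)) \<partial>lborel) \<le> 0"
      by simp
  qed simp
  then have "(\<integral>\<^sup>+\<omega>. indicator N (path (Suc n) \<omega> (Suc n)) \<partial>M) = 0" by simp
  then have "AE \<omega> in M. indicator N (path (Suc n) \<omega> (Suc n)) = (0::ennreal)"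
    by (subst (asm) nn_integral_0_iff_AE) auto
  then show "AE \<omega> in M. y (Suc n) \<omega> \<notin> N"
    by (rule AE_mp) (auto simp: path_eq indicator_def split: if_splits)
qed

text \<open>A conditional Borel-Cantelli argument. While the scale condition holds, a hit at step
  \<open>t\<close> has conditional probability of order at least \<open>1 / Suc t\<close>, and the
  harmonic series diverges, so the condition cannot hold without a hit at all times after
  \<open>T\<close>. Natural \<open>T\<close> and \<open>K\<close> keep the exceptional sets
  countable in number.\<close>

lemma AE_hits:
  assumes S[measurable]: "S \<in> sets borel" and c0: "c0 > 0" and l0: "l0 \<ge> exp (exp 1)"
    and dense: "\<And>l. l \<ge> l0 \<Longrightarrow> c0 * l / ln (ln l) \<le> measure lborel (S \<inter> {-l..l})"
  shows "AE \<omega> in M. \<forall>T K :: nat. \<exists>t\<ge>T. sc t (outputs \<omega>) \<ge> l0 \<and> ln (ln (sc t (outputs \<omega>))) \<le> real (Suc K * Suc t) \<longrightarrow>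
     \<bar>y (Suc t) \<omega>\<bar> \<le> sc t (outputs \<omega>) \<and> y (Suc t) \<omega> \<in> S"
  unfolding AE_all_countable
proof (intro allI)
  fix T K :: nat
  define hit where "hit t p \<longleftrightarrow> \<bar>p (Suc t)\<bar> \<le> sc t p \<and> p (Suc t) \<in> S" for t p
  define G where "G t p \<longleftrightarrow> sc t p \<ge> l0 \<and> ln (ln (sc t p)) \<le> real (Suc K * Suc t)" for t p
  \<comment> \<open>At every time from \<open>T\<close> up to but excluding \<open>n\<close> the
    scale condition held and no hit occurred.\<close>
  define B where "B n p \<longleftrightarrow> (\<forall>t\<in>{T..<n}. G t p \<and> \<not> hit t p)" for n p
  define V where "V n p = (if B n p then 1 else 0 :: ennreal)" for n p
  \<comment> \<open>Within \<open>{-\<sigma>..\<sigma>}\<close> the normal density is at least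
    \<open>exp (- 1 / 2) / (sqrt (2 * pi) * \<sigma>)\<close>. Multiplied by the measure bound, in
    which \<open>ln (ln \<sigma>)\<close> is replaced by its upper bound
    \<open>Suc K * Suc n\<close>, the factor \<open>\<sigma>\<close> cancels.\<close>
  define c where "c = c0 * exp (- 1 / 2) / (sqrt (2 * pi) * real (Suc K))"
  have c: "c > 0" using c0 by (simp add: c_def)
  have [measurable]: "Measurable.pred paths (hit t)" for t
  proof -
    have c: "(\<lambda>p. p (Suc t)) \<in> borel_measurable paths"
      by (rule measurable_component_singleton) simp
    have "{p \<in> space paths. \<bar>p (Suc t)\<bar> \<le> sc t p} \<in> sets paths"
      by (intro borel_measurable_le borel_measurable_abs c measurable_predictive_sd f_measurable)
    moreover have "{p \<in> space paths. p (Suc t) \<in> S} \<in> sets paths"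
      using measurable_sets[OF c S] by (simp add: vimage_def Int_def conj_commute)
    ultimately show ?thesis
      unfolding hit_def pred_def by (intro sets.sets_Collect_conj)
  qed
  have [measurable]: "Measurable.pred paths (G t)" for t
    unfolding G_def[abs_def] by measurable
  have [measurable]: "V n \<in> borel_measurable paths" for n
    unfolding V_def[abs_def] B_def[abs_def] by measurable
  have hit_cong: "hit t p = hit t q" and G_cong: "G t p = G t q"
    if "\<And>i. i \<le> Suc t \<Longrightarrow> p i = q i" for t p q
    using that predictive_sd_cong[of t p q f P0] by (auto simp: hit_def G_def)
  have B_cong: "B n p = B n q" if "\<And>i. i \<le> n \<Longrightarrow> p i = q i" for n p q
    unfolding B_def using that
    by (intro ball_cong refl arg_cong2[where f="(\<and>)"] arg_cong[where f=Not] hit_cong G_cong) auto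
  have step: "(\<integral>\<^sup>+s. ennreal (normal_density 0 (sc n p) s) * V (Suc n) (p(Suc n := s)) \<partial>lborel)
      \<le> ennreal (exp (- c / real (Suc n))) * V n p" if n: "n \<ge> T" for n p
  proof (cases "B n p \<and> G n p")
    case False
    have "\<not> B (Suc n) (p(Suc n := s))" for s
    proof
      assume "B (Suc n) (p(Suc n := s))"
      then have "B n (p(Suc n := s))" "sc n (p(Suc n := s)) \<ge> l0 \<and> ln (ln (sc n (p(Suc n := s)))) \<le> real (Suc K * Suc n)"
        using n by (auto simp: B_def G_def)
      then show False
        using False B_cong[of n "p(Suc n := s)" p] by (simp add: G_def predictive_sd_update)
    qed
    then show ?thesis by (simp add: V_def)
  next
    case True
    define \<sigma> where "\<sigma> = sc n p"
    define A where "A = S \<inter> {-\<sigma>..\<sigma>}"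
    have \<sigma>: "\<sigma> > 0" "\<sigma> \<ge> l0" "ln (ln \<sigma>) \<le> real (Suc K * Suc n)"
      using True by (auto simp: \<sigma>_def G_def sc_pos)
    have ll: "ln (ln \<sigma>) \<ge> 1"
    proof -
      have "exp 1 \<le> ln \<sigma>"
        using \<sigma> l0 by (metis exp_gt_zero ln_exp ln_le_cancel_iff order_trans)
      then show ?thesis
        by (metis exp_gt_zero ln_exp ln_le_cancel_iff order_less_le_trans)
    qed
    have A: "A \<in> sets borel" "A \<subseteq> {-\<sigma>..\<sigma>}" by (auto simp: A_def)
    have "c0 * \<sigma> / real (Suc K * Suc n) \<le> c0 * \<sigma> / ln (ln \<sigma>)"
      using \<sigma> ll c0 by (intro divide_left_mono) auto
    also have "\<dots> \<le> measure lborel A"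
      unfolding A_def by (rule dense[OF \<sigma>(2)])
    finally have "c0 * \<sigma> / real (Suc K * Suc n) * (exp (- \<sigma>\<^sup>2 / (2 * \<sigma>\<^sup>2)) / (sqrt (2 * pi) * \<sigma>))
        \<le> measure lborel A * (exp (- \<sigma>\<^sup>2 / (2 * \<sigma>\<^sup>2)) / (sqrt (2 * pi) * \<sigma>))"
      using \<sigma> by (intro mult_right_mono) auto
    moreover have "c0 * \<sigma> / real (Suc K * Suc n) * (exp (- \<sigma>\<^sup>2 / (2 * \<sigma>\<^sup>2)) / (sqrt (2 * pi) * \<sigma>)) = c / real (Suc n)"
      using \<sigma>(1) by (simp add: c_def divide_simps del: mult_Suc mult_Suc_right of_nat_Suc)
    ultimately have cA: "c / real (Suc n) \<le> measure lborel A * (exp (- \<sigma>\<^sup>2 / (2 * \<sigma>\<^sup>2)) / (sqrt (2 * pi) * \<sigma>))"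
      by simp
    have "B (Suc n) (p(Suc n := s)) \<longrightarrow> s \<notin> A" for s
      using n by (auto simp: B_def A_def hit_def predictive_sd_update \<sigma>_def)
    then have "(\<integral>\<^sup>+s. ennreal (normal_density 0 (sc n p) s) * V (Suc n) (p(Suc n := s)) \<partial>lborel) \<le>
        (\<integral>\<^sup>+s. ennreal (normal_density 0 \<sigma> s) * ennreal (if s \<in> A then 0 else 1) \<partial>lborel)"
      unfolding \<sigma>_def[symmetric] by (intro nn_integral_mono mult_left_mono) (auto simp: V_def)
    also have "\<dots> \<le> ennreal (1 - (1 - 0) * (c / real (Suc n)))"
      by (rule nn_integral_normal_two_levels[OF \<sigma>(1) A _ _ cA]) auto
    also have "\<dots> \<le> ennreal (exp (- c / real (Suc n)))"
      using exp_ge_add_one_self[of "- c / real (Suc n)"] by (intro ennreal_leI) simp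
    finally show ?thesis using True by (simp add: V_def)
  qed
  \<comment> \<open>The harmonic sum over \<open>T + 1, ..., T + n\<close>, accumulated in the
    exponent by the successive factors.\<close>
  define h :: "nat \<Rightarrow> real" where "h n = - harm T + harm (n + T)" for n
  have E: "(\<integral>\<^sup>+\<omega>. V (T + n) (path (T + n) \<omega>) \<partial>M) \<le> ennreal (exp (- c * h n))" for n
  proof (induction n)
    case 0
    have "(\<integral>\<^sup>+\<omega>. V T (path T \<omega>) \<partial>M) \<le> (\<integral>\<^sup>+\<omega>. 1 \<partial>M)"
      by (intro nn_integral_mono) (auto simp: V_def)
    then show ?case by (simp add: emeasure_space_1 h_def)
  next
    case (Suc n)
    have "(\<integral>\<^sup>+\<omega>. V (T + Suc n) (path (T + Suc n) \<omega>) \<partial>M) \<le>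
        (\<integral>\<^sup>+\<omega>. ennreal (exp (- c / real (Suc (T + n)))) * V (T + n) (path (T + n) \<omega>) \<partial>M)"
      unfolding add_Suc_right by (rule nn_integral_output_le[OF _ step]) simp_all
    also have "\<dots> = ennreal (exp (- c / real (Suc (T + n)))) * (\<integral>\<^sup>+\<omega>. V (T + n) (path (T + n) \<omega>) \<partial>M)"
      by (rule nn_integral_cmult) simp
    also have "\<dots> \<le> ennreal (exp (- c / real (Suc (T + n)))) * ennreal (exp (- c * h n))"
      by (intro mult_left_mono Suc.IH) simp
    also have "\<dots> = ennreal (exp (- c * h (Suc n)))"
      by (simp add: ennreal_mult'[symmetric] exp_add[symmetric] h_def harm_Suc divide_inverse algebra_simps)
    finally show ?case .
  qed
  have "filterlim h at_top sequentially"
    unfolding h_def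
    by (intro filterlim_tendsto_add_at_top[OF tendsto_const] filterlim_compose[OF harm_at_top] filterlim_add_const_nat_at_top)
  then have "(\<lambda>n. exp (- c * h n)) \<longlonglongrightarrow> 0"
    by (intro filterlim_compose[OF exp_at_bot] filterlim_tendsto_neg_mult_at_bot[OF tendsto_const]) (use c in auto)
  define Z where "Z = {\<omega> \<in> space M. \<forall>n. B (T + n) (path (T + n) \<omega>)}"
  show "AE \<omega> in M. \<exists>t\<ge>T. sc t (outputs \<omega>) \<ge> l0 \<and> ln (ln (sc t (outputs \<omega>))) \<le> real (Suc K * Suc t) \<longrightarrow>
     \<bar>y (Suc t) \<omega>\<bar> \<le> sc t (outputs \<omega>) \<and> y (Suc t) \<omega> \<in> S"
  proof -
    have [measurable]: "Z \<in> sets M"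
    proof -
      have "Z = {\<omega> \<in> space M. \<forall>n. V (T + n) (path (T + n) \<omega>) = 1}"
        by (auto simp: Z_def V_def)
      also have "\<dots> \<in> sets M" by measurable
      finally show ?thesis .
    qed
    have "prob Z \<le> exp (- c * h n)" for n
    proof -
      have "emeasure M Z = (\<integral>\<^sup>+\<omega>. indicator Z \<omega> \<partial>M)" by simp
      also have "\<dots> \<le> (\<integral>\<^sup>+\<omega>. V (T + n) (path (T + n) \<omega>) \<partial>M)"
        by (intro nn_integral_mono) (auto simp: Z_def V_def indicator_def)
      also note E[of n]
      finally show ?thesis by (simp add: emeasure_eq_measure)
    qed
    with \<open>(\<lambda>n. exp (- c * h n)) \<longlonglongrightarrow> 0\<close> have "prob Z \<le> 0"
      by (intro LIMSEQ_le_const) auto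
    then have "emeasure M Z = 0"
      by (simp add: emeasure_eq_measure measure_le_0_iff)
    then have "AE \<omega> in M. \<omega> \<notin> Z"
      by (intro AE_not_in) (auto simp: null_sets_def)
    then show ?thesis
    proof (rule AE_mp, intro AE_I2 impI)
      fix \<omega> assume \<omega>: "\<omega> \<in> space M" "\<omega> \<notin> Z"
      then obtain n where "\<not> B (T + n) (path (T + n) \<omega>)"
        by (auto simp: Z_def)
      moreover have "B (T + n) (path (T + n) \<omega>) = B (T + n) (outputs \<omega>)"
        using \<omega> by (intro B_cong) (simp add: path_eq)
      ultimately show "\<exists>t\<ge>T. sc t (outputs \<omega>) \<ge> l0 \<and> ln (ln (sc t (outputs \<omega>))) \<le> real (Suc K * Suc t) \<longrightarrow>
          \<bar>y (Suc t) \<omega>\<bar> \<le> sc t (outputs \<omega>) \<and> y (Suc t) \<omega> \<in> S"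
        by (auto simp: B_def G_def hit_def)
    qed
  qed
qed

end

section \<open>The recursion for the logarithmic growth rate\<close>

text \<open>Shifting the quadratic by one turns its roots into the fixed points of
  \<open>x \<mapsto> a * (1 - 1 / x)\<close>. For \<open>a \<ge> 4\<close> they are real; the
  explicit factorization identifies the least one, and \<open>a - 4 \<le> D < a - 2\<close> locates
  it.\<close>

lemma x_min_properties:
  assumes a: "a \<ge> 4"
  defines "z \<equiv> 1 + x_min a"
  shows "z\<^sup>2 = a * z - a" "1 < z" "z \<le> 2"
proof -
  define D where "D = sqrt (a\<^sup>2 - 4 * a)"
  have D2: "D\<^sup>2 = a\<^sup>2 - 4 * a"
    using a by (simp add: D_def power2_eq_square)
  have D0: "D \<ge> 0" using a by (simp add: D_def power2_eq_square)
  have "D\<^sup>2 < (a - 2)\<^sup>2" unfolding D2 by (simp add: power2_eq_square algebra_simps)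
  then have Dl: "D < a - 2" by (rule power2_less_imp_less) (use a in simp)
  have "(a - 4)\<^sup>2 \<le> D\<^sup>2" unfolding D2 using a by (simp add: power2_eq_square algebra_simps)
  then have Dg: "a - 4 \<le> D" using D0 by (rule power2_le_imp_le)
  define r where "r = (a - 2 - D) / 2"
  have root: "x\<^sup>2 - (a - 2) * x + 1 = (x - r) * (x - (r + D))" for x
    using D2 by (simp add: r_def power2_eq_square field_simps)
  have "x_min a = r"
    unfolding x_min_def root by (rule Least_equality) (use D0 in auto)
  then have z: "z = 1 + r" by (simp add: z_def)
  show "z\<^sup>2 = a * z - a"
    using root[of r] unfolding z by (simp add: power2_eq_square algebra_simps)
  show "1 < z" "z \<le> 2"
    using Dl Dg by (simp_all add: z r_def)
qed

lemma no_infinite_descent: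
  fixes q :: "nat \<Rightarrow> real"
  assumes \<eta>: "\<eta> > 0" and descent: "\<And>t. t \<ge> T \<Longrightarrow> Q t \<Longrightarrow> q (Suc t) \<le> q t - \<eta>"
    and lower: "\<And>t. t \<ge> T \<Longrightarrow> Q t \<Longrightarrow> l \<le> q t"
  shows "\<exists>t\<ge>T. \<not> Q t"
proof (rule ccontr)
  assume "\<not> ?thesis"
  then have Q: "Q t" if "t \<ge> T" for t using that by blast
  have le: "q (T + n) \<le> q T - real n * \<eta>" for n
  proof (induction n)
    case (Suc n)
    then show ?case using descent[of "T + n"] Q[of "T + n"] by (simp add: algebra_simps)
  qed simp
  obtain n where "q T - l < real n * \<eta>"
    using reals_Archimedean3[OF \<eta>] by blast
  then show False using le[of n] lower[of "T + n"] Q[of "T + n"] by simp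
qed

text \<open>Deterministic setting for the argument by contradiction: \<open>\<rho>\<close> will be
  the log-information, \<open>\<delta>\<close> will be \<open>ln 2\<close> because a variance above
  2 doubles the information, and \<open>e\<close> collects logarithmic errors. The increment of
  \<open>\<rho>\<close> is twice the logarithm of the predictive standard deviation.\<close>

context
  fixes \<rho> e :: "nat \<Rightarrow> real" and a \<delta> :: real and T :: nat
  assumes \<delta>: "\<delta> > 0" and a: "a > 0"
    and growth: "\<And>t. t \<ge> T \<Longrightarrow> \<rho> t + \<delta> \<le> \<rho> (Suc t)"
    and step: "\<And>t. t \<ge> T \<Longrightarrow> \<rho> (Suc (Suc t)) \<le> a * (\<rho> (Suc t) - \<rho> t) + e t"
    and sublinear: "(\<lambda>t. e t / real t) \<longlonglongrightarrow> 0"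
begin

lemma eventually_linear_lower: "\<forall>\<^sub>F t in sequentially. \<delta> / 2 * real t \<le> \<rho> t"
proof -
  have le: "\<rho> (T + n) \<ge> \<rho> T + real n * \<delta>" for n
  proof (induction n)
    case (Suc n)
    then show ?case using growth[of "T + n"] by (simp add: algebra_simps)
  qed simp
  obtain N where N: "2 * (real T * \<delta> - \<rho> T) / \<delta> \<le> real N"
    using real_arch_simple by blast
  have "\<forall>\<^sub>F t in sequentially. t \<ge> max T N" by (rule eventually_ge_at_top)
  then show ?thesis
  proof eventually_elim
    case (elim t)
    have "2 * (real T * \<delta> - \<rho> T) \<le> real t * \<delta>"
    proof -
      have "2 * (real T * \<delta> - \<rho> T) \<le> real N * \<delta>" using N \<delta> by (simp add: divide_simps)
      also have "\<dots> \<le> real t * \<delta>" using elim \<delta> by (intro mult_right_mono) auto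
      finally show ?thesis .
    qed
    moreover have "\<rho> t \<ge> \<rho> T + real (t - T) * \<delta>"
      using le[of "t - T"] elim by simp
    ultimately show ?case using elim by (simp add: of_nat_diff algebra_simps)
  qed
qed

lemma eventually_error_small:
  assumes "\<epsilon> > 0"
  shows "\<forall>\<^sub>F t in sequentially. e t \<le> \<epsilon> * real t"
proof -
  have "\<forall>\<^sub>F t in sequentially. e t / real t < \<epsilon>"
    using order_tendstoD(2)[OF sublinear assms] .
  moreover have "\<forall>\<^sub>F t in sequentially. t > (0::nat)" by (rule eventually_gt_at_top)
  ultimately show ?thesis by eventually_elim (simp add: divide_simps)
qed

text \<open>As \<open>\<rho>\<close> grows at least linearly, the sublinear error is negligible
  relative to \<open>\<rho> (Suc t)\<close>, the denominator of the next ratio.\<close>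

lemma eventually_ratio:
  assumes "\<epsilon> > 0"
  shows "\<forall>\<^sub>F t in sequentially. t \<ge> T \<and> 0 < \<rho> t \<and> \<rho> t < \<rho> (Suc t) \<and> e t \<le> \<epsilon> * \<rho> (Suc t)"
proof -
  have "\<forall>\<^sub>F t in sequentially. e t \<le> (\<epsilon> * \<delta> / 2) * real t"
    by (rule eventually_error_small) (use assms \<delta> in simp)
  moreover have "\<forall>\<^sub>F t in sequentially. t \<ge> max 1 T" by (rule eventually_ge_at_top)
  ultimately show ?thesis
    using eventually_linear_lower
  proof eventually_elim
    case (elim t)
    have "0 < \<delta> / 2 * real t" using elim \<delta> by simp
    then have pos: "0 < \<rho> t" using elim by linarith
    have inc: "\<rho> t < \<rho> (Suc t)" using growth[of t] \<delta> elim by simp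
    have "e t \<le> \<epsilon> * (\<delta> / 2 * real t)" using elim by simp
    also have "\<dots> \<le> \<epsilon> * \<rho> (Suc t)" using elim inc assms by (intro mult_left_mono) auto
    finally show ?case using pos inc elim by simp
  qed
qed

text \<open>If the increment were small, \<open>step\<close> would force
  \<open>\<rho> (Suc (Suc t))\<close> below \<open>\<rho> t\<close>. The bound later drives the
  predictive standard deviation above any threshold.\<close>

lemma increments_lower: "\<forall>\<^sub>F t in sequentially. \<delta> / (4 * a) * real t \<le> \<rho> (Suc t) - \<rho> t"
proof -
  have "\<forall>\<^sub>F t in sequentially. e t \<le> \<delta> / 4 * real t"
    by (rule eventually_error_small) (use \<delta> in simp)
  moreover have "\<forall>\<^sub>F t in sequentially. t \<ge> T" by (rule eventually_ge_at_top)
  ultimately show ?thesis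
    using eventually_linear_lower
  proof eventually_elim
    case (elim t)
    have "\<rho> t \<le> \<rho> (Suc (Suc t))"
      using growth[of t] growth[of "Suc t"] elim \<delta> by simp
    then have "\<delta> / 4 * real t \<le> a * (\<rho> (Suc t) - \<rho> t)"
      using step[of t] elim by simp
    then show ?case using a by (simp add: field_simps)
  qed
qed

text \<open>Eventually \<open>\<rho> (Suc (Suc t)) \<le> (a + 1) * \<rho> (Suc t)\<close>, so
  \<open>\<rho>\<close> grows at most geometrically. This bounds the iterated logarithm of the
  predictive standard deviation linearly in time, as the hitting estimate requires.\<close>

lemma increments_upper: "\<exists>K::nat. \<forall>\<^sub>F t in sequentially. ln (\<rho> (Suc t) - \<rho> t) \<le> real (Suc K * Suc t)"
proof -
  obtain T1 where T1: "\<And>t. t \<ge> T1 \<Longrightarrow> t \<ge> T \<and> 0 < \<rho> t \<and> \<rho> t < \<rho> (Suc t) \<and> e t \<le> 1 * \<rho> (Suc t)"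
    using eventually_ratio[of 1] unfolding eventually_sequentially by auto
  have le: "ln (\<rho> (Suc T1 + n)) \<le> ln (\<rho> (Suc T1)) + real n * ln (a + 1)" for n
  proof (induction n)
    case (Suc n)
    let ?t = "T1 + n"
    have "\<rho> (Suc (Suc ?t)) \<le> a * \<rho> (Suc ?t) + \<rho> (Suc ?t)"
    proof -
      have "a * (\<rho> (Suc ?t) - \<rho> ?t) \<le> a * \<rho> (Suc ?t)"
        using T1[of ?t] a by (intro mult_left_mono) auto
      then show ?thesis using step[of ?t] T1[of ?t] by linarith
    qed
    then have "\<rho> (Suc (Suc ?t)) \<le> (a + 1) * \<rho> (Suc ?t)" by (simp add: algebra_simps)
    then have "ln (\<rho> (Suc (Suc ?t))) \<le> ln ((a + 1) * \<rho> (Suc ?t))"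
      using T1[of "Suc (Suc ?t)"] by (intro ln_mono) auto
    also have "\<dots> = ln (a + 1) + ln (\<rho> (Suc ?t))"
      using T1[of "Suc ?t"] a by (intro ln_mult_pos) auto
    finally show ?case using Suc by (simp add: algebra_simps)
  qed simp
  obtain K :: nat where K: "\<bar>ln (\<rho> (Suc T1))\<bar> + ln (a + 1) \<le> real K"
    using real_arch_simple by blast
  have "ln (\<rho> (Suc t) - \<rho> t) \<le> real (Suc K * Suc t)" if "t \<ge> T1" for t
  proof -
    have "ln (\<rho> (Suc t) - \<rho> t) \<le> ln (\<rho> (Suc t))"
      using T1[OF that] by (intro ln_mono) auto
    also have "\<dots> \<le> ln (\<rho> (Suc T1)) + real (t - T1) * ln (a + 1)"
      using le[of "t - T1"] that by simp
    also have "\<dots> \<le> \<bar>ln (\<rho> (Suc T1))\<bar> * real (Suc t) + real (Suc t) * ln (a + 1)"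
    proof (intro add_mono mult_right_mono)
      have "\<bar>ln (\<rho> (Suc T1))\<bar> * 1 \<le> \<bar>ln (\<rho> (Suc T1))\<bar> * real (Suc t)"
        by (intro mult_left_mono) auto
      then show "ln (\<rho> (Suc T1)) \<le> \<bar>ln (\<rho> (Suc T1))\<bar> * real (Suc t)" by linarith
    qed (use a in auto)
    also have "\<dots> = (\<bar>ln (\<rho> (Suc T1))\<bar> + ln (a + 1)) * real (Suc t)"
      by (simp add: algebra_simps)
    also have "\<dots> \<le> real (Suc K) * real (Suc t)"
      using K by (intro mult_right_mono) auto
    finally show ?thesis by (simp only: of_nat_mult)
  qed
  then show ?thesis unfolding eventually_sequentially by blast
qed

text \<open>The ratios of consecutive values of \<open>\<rho>\<close> descend below a level
  \<open>M\<close> just above \<open>Z\<close> and stay there. One hit then throws them below some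
  \<open>m < z\<close>, from where they would have to descend forever although they exceed
  1.\<close>

lemma no_frequent_hits:
  assumes z: "z\<^sup>2 = a * z - a" "1 < z" "z \<le> 2" and b: "0 \<le> b" "b < z\<^sup>2"
    and hits: "\<And>T'. \<exists>t\<ge>T'. \<rho> (Suc (Suc t)) \<le> b * (\<rho> (Suc t) - \<rho> t) + e t"
  shows False
proof -
  define Z where "Z = a - z"
  have az: "a * (z - 1) = z\<^sup>2" using z by (simp add: algebra_simps)
  have prod: "z * Z = a" using z(1) by (simp add: Z_def power2_eq_square algebra_simps)
  have Z: "Z * (z - 1) = z"
    using az unfolding Z_def by (simp add: power2_eq_square algebra_simps)
  have zZ: "z \<le> Z"
  proof -
    have "z * (z - 1) \<le> z * 1" using z by (intro mult_left_mono) auto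
    then have "z * (z - 1) \<le> Z * (z - 1)" using Z by simp
    then show ?thesis using z by simp
  qed
  \<comment> \<open>The downward displacement under the map, in factored form; it is positive
    outside the interval between the fixed points.\<close>
  have drift: "x - a * (1 - 1 / x) = (x - z) * (x - Z) / x" if "x > 0" for x
  proof -
    have "(x - z) * (x - Z) = x * x - a * x + a"
      using prod by (simp add: Z_def algebra_simps)
    then show ?thesis using that by (simp add: field_simps)
  qed
  \<comment> \<open>Since \<open>z\<close> and \<open>Z\<close> satisfy
    \<open>1 / z + 1 / Z = 1\<close>, the image is \<open>b / z\<close>, and the hypothesis
    \<open>b < z\<^sup>2\<close> is exactly what puts it below \<open>z\<close>.\<close>
  have bZ: "b * (1 - 1 / Z) < z"
  proof -
    have "1 - 1 / Z = 1 / z" using Z z zZ by (simp add: field_simps)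
    moreover have "b / z < z" using b z by (simp add: divide_simps power2_eq_square)
    ultimately show ?thesis by simp
  qed
  have "((\<lambda>M. b * (1 - 1 / M)) \<longlongrightarrow> b * (1 - 1 / Z)) (at_right Z)"
    using zZ z by (intro tendsto_intros) auto
  then have "\<forall>\<^sub>F M in at_right Z. b * (1 - 1 / M) < z"
    by (rule order_tendstoD) (rule bZ)
  moreover have "\<forall>\<^sub>F M in at_right Z. Z < M" by (rule eventually_at_right_less)
  ultimately have "\<forall>\<^sub>F M in at_right Z. b * (1 - 1 / M) < z \<and> Z < M" by (rule eventually_conj)
  then obtain M where M: "b * (1 - 1 / M) < z" "Z < M"
    using eventually_happens'[OF trivial_limit_at_right_real] by blast
  obtain m where m: "max 1 (b * (1 - 1 / M)) < m" "m < z"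
    using dense[of "max 1 (b * (1 - 1 / M))" z] M z by auto
  define \<eta>1 where "\<eta>1 = (z - m) * (Z - m) / m"
  define \<eta>2 where "\<eta>2 = (M - z) * (M - Z) / M"
  have \<eta>: "\<eta>1 > 0" "\<eta>2 > 0"
    using m M zZ z by (auto simp: \<eta>1_def \<eta>2_def)
  \<comment> \<open>The error may consume the gap between the image of \<open>M\<close> under a hit
    and \<open>m\<close>, and half of the drift on either side.\<close>
  define \<epsilon> where "\<epsilon> = min (m - b * (1 - 1 / M)) (min (\<eta>1 / 2) (\<eta>2 / 2))"
  have \<epsilon>: "\<epsilon> > 0" "\<epsilon> \<le> m - b * (1 - 1 / M)" "\<epsilon> \<le> \<eta>1 / 2" "\<epsilon> \<le> \<eta>2 / 2"
    unfolding \<epsilon>_def using \<eta> m by linarith+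
  have low: "\<eta>1 \<le> x - a * (1 - 1 / x)" if "1 < x" "x \<le> m" for x
  proof -
    have "\<eta>1 \<le> (z - x) * (Z - x) / x"
      unfolding \<eta>1_def using that m zZ by (intro frac_le mult_mono) auto
    also have "\<dots> = (x - z) * (x - Z) / x" by (simp add: algebra_simps)
    finally show ?thesis using drift[of x] that by simp
  qed
  have high: "\<eta>2 \<le> x - a * (1 - 1 / x)" if "M \<le> x" for x
  proof -
    have M0: "M > 0" "Z > 0" using M zZ z by auto
    have "\<eta>2 = (M - z) * (1 - Z / M)" using M0 by (simp add: \<eta>2_def field_simps)
    also have "\<dots> \<le> (x - z) * (1 - Z / x)"
      using that M0 M zZ by (intro mult_mono diff_mono divide_left_mono) (auto simp: field_simps)
    also have "\<dots> = (x - z) * (x - Z) / x" using that M0 by (simp add: field_simps)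
    finally show ?thesis using drift[of x] that M0 by simp
  qed
  \<comment> \<open>\<open>x \<mapsto> a * (1 - 1 / x)\<close> has the fixed points \<open>z \<le> Z\<close>, moves points above \<open>Z\<close> and points below \<open>z\<close> down, and a
    hit at a ratio near \<open>Z\<close> leads to a ratio near \<open>b / z < z\<close>.\<close>
  define q where "q t = \<rho> (Suc t) / \<rho> t" for t
  obtain T1 where T1: "\<And>t. t \<ge> T1 \<Longrightarrow> t \<ge> T \<and> 0 < \<rho> t \<and> \<rho> t < \<rho> (Suc t) \<and> e t \<le> \<epsilon> * \<rho> (Suc t)"
    using eventually_ratio[OF \<epsilon>(1)] unfolding eventually_sequentially by auto
  have q1: "q t > 1" if "t \<ge> T1" for t
    using T1[OF that] by (simp add: q_def)
  have ratio: "q (Suc t) \<le> c * (1 - 1 / q t) + \<epsilon>"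
    if "t \<ge> T1" "\<rho> (Suc (Suc t)) \<le> c * (\<rho> (Suc t) - \<rho> t) + e t" for t c
  proof -
    have p: "\<rho> (Suc t) > 0" "\<rho> t > 0" using T1[OF that(1)] by auto
    have "\<rho> (Suc (Suc t)) \<le> c * (\<rho> (Suc t) - \<rho> t) + \<epsilon> * \<rho> (Suc t)"
      using that T1[OF that(1)] by linarith
    then show ?thesis using p by (simp add: q_def field_simps)
  qed
  have qstep: "q (Suc t) \<le> a * (1 - 1 / q t) + \<epsilon>" if "t \<ge> T1" for t
    using ratio[OF that step] T1[OF that] by simp
  have mono: "c * (1 - 1 / x) \<le> c * (1 - 1 / x')" if "c \<ge> 0" "0 < x" "x \<le> x'" for c x x' :: real
    using that by (intro mult_left_mono diff_mono divide_left_mono) auto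
  have "\<exists>t\<ge>T1. \<not> M < q t"
  proof (rule no_infinite_descent[where q = q and l = 0])
    show "\<eta>2 / 2 > 0" using \<eta> by simp
    show "q (Suc t) \<le> q t - \<eta>2 / 2" if "t \<ge> T1" "M < q t" for t
      using qstep[OF that(1)] high[of "q t"] that \<epsilon> by linarith
    show "0 \<le> q t" if "t \<ge> T1" for t using q1[OF that] by simp
  qed
  then obtain T2 where T2: "T2 \<ge> T1" "q T2 \<le> M" by (auto simp: not_less)
  \<comment> \<open>The map is increasing and sends \<open>M\<close> to a point lower by
    \<open>\<eta>2\<close>, more than the error can restore.\<close>
  have qM: "q t \<le> M" if "t \<ge> T2" for t
    using that
  proof (induction t rule: dec_induct)
    case (step t)
    have t: "t \<ge> T1" using step T2 by simp
    have "a * (1 - 1 / q t) \<le> a * (1 - 1 / M)"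
      using q1[OF t] step a by (intro mono) auto
    then show ?case using qstep[OF t] high[of M] \<epsilon> \<eta> by linarith
  qed (rule T2)
  obtain t where t: "t \<ge> T2" "\<rho> (Suc (Suc t)) \<le> b * (\<rho> (Suc t) - \<rho> t) + e t"
    using hits by blast
  have "b * (1 - 1 / q t) \<le> b * (1 - 1 / M)"
    using q1[of t] qM[OF t(1)] t T2 b by (intro mono) auto
  then have qm: "q (Suc t) \<le> m"
    using ratio[OF _ t(2)] t T2 \<epsilon> by simp
  have qm': "q s \<le> m" if "s \<ge> Suc t" for s
    using that
  proof (induction s rule: dec_induct)
    case (step s)
    then show ?case using qstep[of s] low[of "q s"] q1[of s] \<epsilon> \<eta> t T2 by simp
  qed (rule qm)
  \<comment> \<open>With the constantly true predicate, the conclusion of the descent lemma is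
    itself the contradiction.\<close>
  have "\<exists>s\<ge>Suc t. \<not> True"
  proof (rule no_infinite_descent[where q = q and l = 0])
    show "\<eta>1 / 2 > 0" using \<eta> by simp
    show "q (Suc s) \<le> q s - \<eta>1 / 2" if "s \<ge> Suc t" for s
      using qstep[of s] low[of "q s"] q1[of s] qm'[OF that] that \<epsilon> t T2 by simp
    show "0 \<le> q s" if "s \<ge> Suc t" for s using q1[of s] that t T2 by simp
  qed
  then show False by simp
qed

end

section \<open>Conditions on the nonlinearity\<close>

lemma piecewise_continuous_borel_measurable:
  assumes "piecewise_continuous f"
  shows "f \<in> borel_measurable borel"
proof (rule borel_measurable_continuous_countable_exceptions)
  have "{x. \<not> isCont f x} = (\<Union>n::nat. {x \<in> {- real n..real n}. \<not> isCont f x})"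
  proof (intro equalityI subsetI)
    fix x assume x: "x \<in> {x. \<not> isCont f x}"
    obtain n :: nat where "\<bar>x\<bar> \<le> real n" using real_arch_simple by blast
    then have "x \<in> {- real n..real n}" by auto
    with x show "x \<in> (\<Union>n::nat. {x \<in> {- real n..real n}. \<not> isCont f x})" by blast
  qed auto
  also have "countable \<dots>"
    using assms unfolding piecewise_continuous_def by (intro countable_UN) (auto intro: countable_finite)
  finally show "countable {x. \<not> isCont f x}" .
  show "continuous_on (- {x. \<not> isCont f x}) f"
    by (rule continuous_at_imp_continuous_on) auto
qed

text \<open>Near each point the one-sided limits bound \<open>f\<close>, with the value at the point
  added separately; bisection extends the local bounds to the interval.\<close>

lemma piecewise_continuous_bounded_interval:
  assumes "piecewise_continuous f" and "c \<le> d"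
  shows "\<exists>B. \<forall>x\<in>{c..d}. \<bar>f x\<bar> \<le> B"
  using \<open>c \<le> d\<close>
proof (rule Bolzano[where P = "\<lambda>c d. \<exists>B. \<forall>x\<in>{c..d}. \<bar>f x\<bar> \<le> B"])
  fix u v w :: real
  assume "\<exists>B. \<forall>x\<in>{u..v}. \<bar>f x\<bar> \<le> B" "\<exists>B. \<forall>x\<in>{v..w}. \<bar>f x\<bar> \<le> B"
  then obtain B B' where B: "\<And>x. x \<in> {u..v} \<Longrightarrow> \<bar>f x\<bar> \<le> B" "\<And>x. x \<in> {v..w} \<Longrightarrow> \<bar>f x\<bar> \<le> B'"
    by blast
  have "\<bar>f x\<bar> \<le> max B B'" if "x \<in> {u..w}" for x
    using B[of x] that by (cases "x \<le> v") auto
  then show "\<exists>B. \<forall>x\<in>{u..w}. \<bar>f x\<bar> \<le> B" by blast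
next
  fix x
  obtain l r where lr: "(f \<longlongrightarrow> l) (at_left x)" "(f \<longlongrightarrow> r) (at_right x)"
    using assms(1) unfolding piecewise_continuous_def by blast
  define B where "B = max \<bar>f x\<bar> (max (\<bar>l\<bar> + 1) (\<bar>r\<bar> + 1))"
  have "\<forall>\<^sub>F z in at_left x. \<bar>f z\<bar> \<le> B"
    using order_tendstoD(2)[OF tendsto_rabs[OF lr(1)], of "\<bar>l\<bar> + 1"]
    by (auto simp: B_def elim!: eventually_mono)
  moreover have "\<forall>\<^sub>F z in at_right x. \<bar>f z\<bar> \<le> B"
    using order_tendstoD(2)[OF tendsto_rabs[OF lr(2)], of "\<bar>r\<bar> + 1"]
    by (auto simp: B_def elim!: eventually_mono)
  ultimately have "\<forall>\<^sub>F z in at x. \<bar>f z\<bar> \<le> B"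
    by (simp add: eventually_at_split)
  then obtain \<epsilon> where \<epsilon>: "\<epsilon> > 0" "\<And>z. z \<noteq> x \<Longrightarrow> dist z x < \<epsilon> \<Longrightarrow> \<bar>f z\<bar> \<le> B"
    unfolding eventually_at by auto
  have "\<bar>f z\<bar> \<le> B" if "dist z x < \<epsilon>" for z
    using \<epsilon>(2)[of z] that by (cases "z = x") (auto simp: B_def)
  then have "\<forall>u v. u \<le> x \<and> x \<le> v \<and> v - u < \<epsilon> \<longrightarrow> (\<exists>B. \<forall>z\<in>{u..v}. \<bar>f z\<bar> \<le> B)"
    by (intro allI impI exI[of _ B] ballI) (auto simp: dist_real_def)
  with \<epsilon>(1) show "\<exists>\<epsilon>>0. \<forall>u v. u \<le> x \<and> x \<le> v \<and> v - u < \<epsilon> \<longrightarrow> (\<exists>B. \<forall>z\<in>{u..v}. \<bar>f z\<bar> \<le> B)"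
    by blast
qed

text \<open>The growth condition controls only large arguments; local boundedness covers the rest.
  Using \<open>1 + \<bar>x\<bar>\<close> instead of \<open>\<bar>x\<bar>\<close> gives one bound
  valid everywhere.\<close>

lemma polynomial_growth_bound:
  assumes f: "piecewise_continuous f" and a: "a \<ge> 0"
    and growth: "\<exists>h1\<in>O[at_infinity](\<lambda>x. \<bar>x\<bar> powr a). \<exists>h2\<in>O[at_infinity](\<lambda>_. 1). \<forall>x. \<bar>f x\<bar> = h1 x + h2 x"
  shows "\<exists>C\<ge>1. \<forall>x. \<bar>f x\<bar> \<le> C * (1 + \<bar>x\<bar>) powr a"
proof -
  obtain h1 h2 where h: "h1 \<in> O[at_infinity](\<lambda>x. \<bar>x\<bar> powr a)" "h2 \<in> O[at_infinity](\<lambda>_::real. 1)"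
    and eq: "\<And>x. \<bar>f x\<bar> = h1 x + h2 x"
    using growth by blast
  obtain c1 where c1: "c1 > 0" "\<forall>\<^sub>F x in at_infinity. norm (h1 x) \<le> c1 * norm (\<bar>x\<bar> powr a)"
    using h(1) by (rule landau_o.bigE)
  obtain c2 where c2: "c2 > 0" "\<forall>\<^sub>F x in at_infinity. norm (h2 x) \<le> c2 * norm (1::real)"
    using h(2) by (rule landau_o.bigE)
  have "\<forall>\<^sub>F x in at_infinity. norm (h1 x) \<le> c1 * norm (\<bar>x\<bar> powr a) \<and> norm (h2 x) \<le> c2 * norm (1::real)"
    using c1(2) c2(2) by eventually_elim simp
  then obtain R where R: "\<And>x. norm x \<ge> R \<Longrightarrow> norm (h1 x) \<le> c1 * norm (\<bar>x\<bar> powr a) \<and> norm (h2 x) \<le> c2 * norm (1::real)"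
    unfolding eventually_at_infinity by blast
  have "\<exists>B. \<forall>x\<in>{- \<bar>R\<bar>..\<bar>R\<bar>}. \<bar>f x\<bar> \<le> B"
    by (rule piecewise_continuous_bounded_interval[OF f]) simp
  then obtain B where B: "\<And>x. x \<in> {- \<bar>R\<bar>..\<bar>R\<bar>} \<Longrightarrow> \<bar>f x\<bar> \<le> B"
    by blast
  define C where "C = c1 + c2 + \<bar>B\<bar> + 1"
  have "\<bar>f x\<bar> \<le> C * (1 + \<bar>x\<bar>) powr a" for x
  proof -
    have one: "1 \<le> (1 + \<bar>x\<bar>) powr a" using a by (intro ge_one_powr_ge_zero) auto
    show ?thesis
    proof (cases "\<bar>x\<bar> \<le> \<bar>R\<bar>")
      case True
      then have "\<bar>f x\<bar> \<le> C * 1"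
        using B[of x] c1 c2 by (simp add: C_def abs_le_iff)
      also have "\<dots> \<le> C * (1 + \<bar>x\<bar>) powr a"
        using one c1 c2 by (intro mult_left_mono) (auto simp: C_def)
      finally show ?thesis .
    next
      case False
      then have "\<bar>f x\<bar> \<le> c1 * \<bar>x\<bar> powr a + c2"
        using R[of x] abs_ge_self[of R] by (auto simp: eq)
      also have "\<dots> \<le> c1 * (1 + \<bar>x\<bar>) powr a + c2 * (1 + \<bar>x\<bar>) powr a"
        using one c1 c2 a by (intro add_mono mult_left_mono powr_mono2) auto
      also have "\<dots> \<le> C * (1 + \<bar>x\<bar>) powr a"
        by (simp add: C_def algebra_simps)
      finally show ?thesis .
    qed
  qed
  moreover have "C \<ge> 1" using c1 c2 by (simp add: C_def)
  ultimately show ?thesis by blast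
qed

text \<open>Any positive number below the lower limit serves as \<open>c0\<close>. The threshold
  \<open>exp (exp 1)\<close> ensures \<open>ln (ln l) \<ge> 1\<close>, so that the inequality may be
  divided by it.\<close>

lemma S_set_density:
  assumes f[measurable]: "f \<in> borel_measurable borel"
    and liminf: "Liminf at_top (\<lambda>l::real. ereal (measure lebesgue (S_set f b L \<inter> {-l..l}) / l * ln (ln l))) > 0"
  shows "\<exists>c0 l0. c0 > 0 \<and> l0 \<ge> exp (exp 1) \<and>
    (\<forall>l\<ge>l0. c0 * l / ln (ln l) \<le> measure lborel (S_set f b L \<inter> {-l..l}))"
proof -
  have S[measurable]: "S_set f b L \<in> sets borel"
    unfolding S_set_def by measurable
  have eq: "measure lebesgue (S_set f b L \<inter> {-l..l}) = measure lborel (S_set f b L \<inter> {-l..l})" for l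
    by (simp add: measure_def)
  obtain c where c: "0 < ereal c" "ereal c < Liminf at_top (\<lambda>l::real. ereal (measure lebesgue (S_set f b L \<inter> {-l..l}) / l * ln (ln l)))"
    using ereal_dense2[OF liminf] by blast
  have "\<forall>\<^sub>F l in at_top. c < measure lborel (S_set f b L \<inter> {-l..l}) / l * ln (ln l)"
    using less_LiminfD[OF c(2)] by (simp add: eq)
  then obtain l1 where l1: "\<And>l. l \<ge> l1 \<Longrightarrow> c < measure lborel (S_set f b L \<inter> {-l..l}) / l * ln (ln l)"
    unfolding eventually_at_top_linorder by blast
  define l0 where "l0 = max l1 (exp (exp 1) :: real)"
  have "c * l / ln (ln l) \<le> measure lborel (S_set f b L \<inter> {-l..l})" if l: "l \<ge> l0" for l
  proof -
    have l2: "exp (exp 1) \<le> l" using l by (simp add: l0_def)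
    then have l3: "l > 0" using exp_gt_zero[of "exp 1"] by linarith
    have "exp 1 \<le> ln l"
      using l2 l3 by (simp add: ln_ge_iff)
    then have "1 \<le> ln (ln l)"
      using exp_gt_zero[of "1::real"] by (subst ln_ge_iff) linarith+
    then show ?thesis
      using l1[of l] l l3 by (simp add: l0_def field_simps)
  qed
  then show ?thesis
    using c(1) by (intro exI[of _ c] exI[of _ l0]) (auto simp: l0_def)
qed

text \<open>
  The exponent is raised to \<open>max b 1\<close> because a negative \<open>b\<close> gives no bound by a power of \<open>\<sigma>\<close>; this is harmless since
  \<open>1 < (1 + x_min a)^2\<close>.
\<close>

lemma S_set_bound:
  assumes f: "\<And>x. \<bar>f x\<bar> \<le> C * (1 + \<bar>x\<bar>) powr a" and C: "C \<ge> 1" and a: "a \<ge> 0" and L: "L > 0"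
    and x: "x \<in> S_set f b L" "\<bar>x\<bar> \<le> \<sigma>" and \<sigma>: "\<sigma> \<ge> 1"
  shows "\<bar>f x\<bar> \<le> (L + C * 2 powr a) * \<sigma> powr max b 1"
proof (cases "\<bar>x\<bar> \<le> 1")
  case True
  have "\<bar>f x\<bar> \<le> C * (1 + \<bar>x\<bar>) powr a" by (rule f)
  also have "\<dots> \<le> C * 2 powr a"
    using True C a by (intro mult_left_mono powr_mono2) auto
  also have "\<dots> \<le> (L + C * 2 powr a) * 1" using L by simp
  also have "\<dots> \<le> (L + C * 2 powr a) * \<sigma> powr max b 1"
    using \<sigma> L C by (intro mult_left_mono ge_one_powr_ge_zero) auto
  finally show ?thesis .
next
  case False
  have "\<bar>f x\<bar> \<le> L * \<bar>x\<bar> powr b" using x by (simp add: S_set_def)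
  also have "\<dots> \<le> L * \<bar>x\<bar> powr max b 1"
    using False L by (intro mult_left_mono powr_mono) auto
  also have "\<dots> \<le> L * \<sigma> powr max b 1"
    using x L by (intro mult_left_mono powr_mono2) auto
  also have "\<dots> \<le> (L + C * 2 powr a) * \<sigma> powr max b 1"
    using C by (intro mult_right_mono) auto
  finally show ?thesis .
qed

section \<open>Stabilization\<close>

text \<open>A statement about a single path. If the variance stayed above 2, the log-information
  would satisfy the recursion above, and its growth bounds would make the premise in
  \<open>hits\<close> true at all late times, so hits would be frequent.\<close>

lemma frequently_small_predictive_sd:
  assumes P0: "P0 > 0" and a: "a \<ge> 4"
    and z: "z\<^sup>2 = a * z - a" "1 < z" "z \<le> 2" and \<beta>: "0 \<le> \<beta>" "\<beta> < z\<^sup>2"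
    and C: "C \<ge> 1" and fC: "\<And>x. \<bar>f x\<bar> \<le> C * (1 + \<bar>x\<bar>) powr a"
    and C': "C' \<ge> 1" and fS: "\<And>x \<sigma>. x \<in> S \<Longrightarrow> \<bar>x\<bar> \<le> \<sigma> \<Longrightarrow> \<sigma> \<ge> 1 \<Longrightarrow> \<bar>f x\<bar> \<le> C' * \<sigma> powr \<beta>"
    and innovation: "\<forall>\<^sub>F n in sequentially. (p (Suc n) / predictive_sd f P0 n p)\<^sup>2 \<le> 8 * ln (real (Suc n))"
    and hits: "\<forall>T K :: nat. \<exists>t\<ge>T. predictive_sd f P0 t p \<ge> l0 \<and> ln (ln (predictive_sd f P0 t p)) \<le> real (Suc K * Suc t) \<longrightarrow>
      \<bar>p (Suc t)\<bar> \<le> predictive_sd f P0 t p \<and> p (Suc t) \<in> S"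
  shows "\<exists>n\<ge>N. (predictive_sd f P0 n p)\<^sup>2 \<le> 2"
proof (rule ccontr)
  assume "\<not> ?thesis"
  then have big: "(predictive_sd f P0 n p)\<^sup>2 > 2" if "n \<ge> N" for n using that by (meson not_le)
  define \<rho> where "\<rho> t = ln (information f P0 t p)" for t
  \<comment> \<open>One error term for both the general step and the hit step;
    \<open>4 * real (Suc t)\<close> comes from the crude polynomial bound on the innovation.\<close>
  define e where "e t = ln 2 + 2 * ln C + 2 * ln C' + 2 * a * ln (4 * real (Suc t))" for t
  define s where "s t = predictive_sd f P0 t p" for t
  have info: "information f P0 t p > 0" for t by (rule information_pos[OF P0])
  have s1: "s t \<ge> 1" for t unfolding s_def by (rule predictive_sd_ge_1[OF P0])
  have ln_s: "2 * ln (s t) = \<rho> (Suc t) - \<rho> t" for t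
  proof -
    have "2 * ln (s t) = ln ((s t)\<^sup>2)" using s1[of t] by (simp add: ln_realpow)
    then show ?thesis using info[of t] info[of "Suc t"] by (simp add: s_def predictive_sd_power2[OF P0] ln_div \<rho>_def)
  qed
  have growth: "\<rho> t + ln 2 \<le> \<rho> (Suc t)" if "t \<ge> N" for t
  proof -
    have "ln 2 \<le> ln ((s t)\<^sup>2)" using big[OF that] by (intro ln_mono) (auto simp: s_def)
    then show ?thesis using ln_s[of t] s1[of t] by (simp add: ln_realpow)
  qed
  \<comment> \<open>A variance above 2 at time \<open>Suc t\<close> means that the newest term
    exceeds all earlier information, so the total is at most twice the square of
    \<open>f (p (Suc t))\<close>.\<close>
  have next_le: "f (p (Suc t)) \<noteq> 0 \<and> \<rho> (Suc (Suc t)) \<le> ln 2 + 2 * ln \<bar>f (p (Suc t))\<bar>" if "t \<ge> N" for t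
  proof -
    have lt: "information f P0 (Suc t) p < (f (p (Suc t)))\<^sup>2"
      using big[of "Suc t"] that info[of "Suc t"]
      by (simp add: predictive_sd_power2[OF P0] information_Suc[of f P0 "Suc t"] field_simps)
    then have nz: "f (p (Suc t)) \<noteq> 0" using info[of "Suc t"] by auto
    have "\<rho> (Suc (Suc t)) \<le> ln (2 * \<bar>f (p (Suc t))\<bar>\<^sup>2)"
      unfolding \<rho>_def using lt info[of "Suc t"]
      by (intro ln_mono) (auto simp: information_Suc[of f P0 "Suc t"] add_pos_nonneg)
    also have "\<dots> = ln 2 + 2 * ln \<bar>f (p (Suc t))\<bar>"
    proof -
      have "ln (2 * v\<^sup>2) = ln 2 + 2 * ln v" if "v > 0" for v :: real
        using that by (simp add: ln_mult_pos ln_realpow)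
      from this[of "\<bar>f (p (Suc t))\<bar>"] show ?thesis using nz by simp
    qed
    finally show ?thesis using nz by blast
  qed
  obtain N1 where N1: "\<And>n. n \<ge> N1 \<Longrightarrow> (p (Suc n) / s n)\<^sup>2 \<le> 8 * ln (real (Suc n))"
    using innovation unfolding s_def eventually_sequentially by blast
  define T where "T = max N N1"
  have step: "\<rho> (Suc (Suc t)) \<le> a * (\<rho> (Suc t) - \<rho> t) + e t" if t: "t \<ge> T" for t
  proof -
    have "(p (Suc t) / s t)\<^sup>2 \<le> 8 * ln (real (Suc t))" using N1 t by (simp add: T_def)
    also have "\<dots> \<le> 8 * real t" using ln_le_minus_one[of "real (Suc t)"] by simp
    \<comment> \<open>A linear bound suffices here: after taking logarithms it contributes only
      \<open>O(ln t)\<close>, which is sublinear.\<close>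
    also have "\<dots> \<le> (3 * real (Suc t))\<^sup>2" by (simp add: power2_eq_square algebra_simps)
    finally have "\<bar>p (Suc t) / s t\<bar>\<^sup>2 \<le> (3 * real (Suc t))\<^sup>2" by (simp only: power2_abs)
    then have "\<bar>p (Suc t) / s t\<bar> \<le> 3 * real (Suc t)" by (rule power2_le_imp_le) simp
    then have "\<bar>p (Suc t)\<bar> \<le> s t * (3 * real (Suc t))"
      using s1[of t] by (simp add: field_simps)
    moreover have "1 * 1 \<le> s t * real (Suc t)" using s1[of t] by (intro mult_mono) auto
    ultimately have p: "1 + \<bar>p (Suc t)\<bar> \<le> s t * (4 * real (Suc t))" by (simp add: algebra_simps)
    have "\<bar>f (p (Suc t))\<bar> \<le> C * (1 + \<bar>p (Suc t)\<bar>) powr a" by (rule fC)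
    also have "\<dots> \<le> C * (s t * (4 * real (Suc t))) powr a"
      using p C a by (intro mult_left_mono powr_mono2) auto
    finally have "ln \<bar>f (p (Suc t))\<bar> \<le> ln (C * (s t * (4 * real (Suc t))) powr a)"
      using next_le[of t] t by (intro ln_mono) (auto simp: T_def)
    also have "\<dots> = ln C + a * (ln (s t) + ln (4 * real (Suc t)))"
    proof -
      have "0 < s t * (4 * real (Suc t))" using s1[of t] by (intro mult_pos_pos) auto
      then show ?thesis using C s1[of t] by (simp add: ln_mult_pos ln_powr del: of_nat_Suc)
    qed
    finally have "2 * ln \<bar>f (p (Suc t))\<bar> \<le> 2 * ln C + a * (2 * ln (s t)) + 2 * a * ln (4 * real (Suc t))"
      by (simp add: algebra_simps)
    moreover have "ln C' \<ge> 0" using C' by simp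
    ultimately show ?thesis using next_le[of t] t unfolding ln_s e_def T_def by simp
  qed
  have hit: "\<rho> (Suc (Suc t)) \<le> \<beta> * (\<rho> (Suc t) - \<rho> t) + e t"
    if t: "t \<ge> T" and S: "\<bar>p (Suc t)\<bar> \<le> s t" "p (Suc t) \<in> S" for t
  proof -
    have "\<bar>f (p (Suc t))\<bar> \<le> C' * s t powr \<beta>"
      using fS[OF S(2,1) s1] .
    then have "ln \<bar>f (p (Suc t))\<bar> \<le> ln (C' * s t powr \<beta>)"
      using next_le[of t] t by (intro ln_mono) (auto simp: T_def)
    also have "\<dots> = ln C' + \<beta> * ln (s t)"
      using C' s1[of t] by (simp add: ln_mult_pos ln_powr)
    finally have "2 * ln \<bar>f (p (Suc t))\<bar> \<le> 2 * ln C' + \<beta> * (2 * ln (s t))" by simp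
    moreover have "ln C \<ge> 0" "2 * a * ln (4 * real (Suc t)) \<ge> 0" using C a by (auto intro!: mult_nonneg_nonneg)
    ultimately show ?thesis using next_le[of t] t unfolding ln_s e_def T_def by simp
  qed
  have sublinear: "(\<lambda>t. e t / real t) \<longlonglongrightarrow> 0"
    unfolding e_def by real_asymp
  have a0: "a > 0" and l2: "ln 2 > (0::real)" using a by auto
  have gr: "\<rho> t + ln 2 \<le> \<rho> (Suc t)" if "t \<ge> T" for t using growth that by (simp add: T_def)
  have "\<exists>K::nat. \<forall>\<^sub>F t in sequentially. ln (\<rho> (Suc t) - \<rho> t) \<le> real (Suc K * Suc t)"
    by (rule increments_upper[where T = T, OF l2 a0 _ _ sublinear]) (erule gr step)+
  then obtain K :: nat where K: "\<forall>\<^sub>F t in sequentially. ln (\<rho> (Suc t) - \<rho> t) \<le> real (Suc K * Suc t)"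
    by blast
  have inc: "\<forall>\<^sub>F t in sequentially. ln 2 / (4 * a) * real t \<le> \<rho> (Suc t) - \<rho> t"
    by (rule increments_lower[where T = T, OF l2 a0 _ _ sublinear]) (erule gr step)+
  have "\<forall>\<^sub>F t in sequentially. 2 * \<bar>ln l0\<bar> \<le> ln 2 / (4 * a) * real t"
    using a0 by real_asymp
  then have "\<forall>\<^sub>F t in sequentially. t \<ge> T \<and> l0 \<le> s t \<and> ln (ln (s t)) \<le> real (Suc K * Suc t)"
    using K inc eventually_ge_at_top[of T]
  proof eventually_elim
    case (elim t)
    have "l0 \<le> s t"
    proof (cases "l0 > 0")
      case True
      have "ln l0 \<le> ln (s t)" using elim ln_s[of t] by simp
      then show ?thesis using True s1[of t] by simp
    qed (use s1[of t] in simp)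
    moreover have "ln (ln (s t)) \<le> ln (\<rho> (Suc t) - \<rho> t)"
    proof -
      have "0 < \<rho> (Suc t) - \<rho> t" using gr[of t] elim l2 by linarith
      then show ?thesis using ln_s[of t] by (intro ln_mono) auto
    qed
    ultimately show ?case using elim by linarith
  qed
  then obtain T0 where T0: "\<And>t. t \<ge> T0 \<Longrightarrow> t \<ge> T \<and> l0 \<le> s t \<and> ln (ln (s t)) \<le> real (Suc K * Suc t)"
    unfolding eventually_sequentially by blast
  have frequent: "\<exists>t\<ge>T'. \<rho> (Suc (Suc t)) \<le> \<beta> * (\<rho> (Suc t) - \<rho> t) + e t" for T'
  proof -
    obtain t where t: "t \<ge> max T' T0" "s t \<ge> l0 \<and> ln (ln (s t)) \<le> real (Suc K * Suc t) \<longrightarrow>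
        \<bar>p (Suc t)\<bar> \<le> s t \<and> p (Suc t) \<in> S"
      using hits unfolding s_def by blast
    then show "\<exists>t\<ge>T'. \<rho> (Suc (Suc t)) \<le> \<beta> * (\<rho> (Suc t) - \<rho> t) + e t"
      using T0[of t] hit[of t] by (intro exI[of _ t]) auto
  qed
  show False
    by (rule no_frequent_hits[where T = T, OF l2 a0 _ _ sublinear z \<beta> frequent]) (erule gr step)+
qed

text \<open>With variance at most 2, the next output is at most
  \<open>4 * sqrt (ln (real (Suc n)))\<close> in modulus, where \<open>16 = 2 * 8\<close>. Its image
  under \<open>f\<close> is then polylogarithmic, hence dominated by the linearly growing
  information, so the information at most doubles.\<close>

lemma eventually_predictive_sd_stays_small:
  assumes P0: "P0 > 0" and a: "a \<ge> 0"
    and C: "C \<ge> 1" and fC: "\<And>x. \<bar>f x\<bar> \<le> C * (1 + \<bar>x\<bar>) powr a"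
    and innovation: "\<forall>\<^sub>F n in sequentially. (p (Suc n) / predictive_sd f P0 n p)\<^sup>2 \<le> 8 * ln (real (Suc n))"
    and \<kappa>: "\<kappa> > 0" and growth: "\<forall>\<^sub>F n in sequentially. \<kappa> * real n \<le> information f P0 (Suc n) p"
  shows "\<forall>\<^sub>F n in sequentially. (predictive_sd f P0 n p)\<^sup>2 \<le> 2 \<longrightarrow> (predictive_sd f P0 (Suc n) p)\<^sup>2 \<le> 2"
proof -
  have "\<forall>\<^sub>F n in sequentially. (C * (1 + 4 * sqrt (ln (real (Suc n)))) powr a)\<^sup>2 \<le> \<kappa> * real n"
    using \<kappa> C a by real_asymp
  then show ?thesis
    using innovation growth
  proof eventually_elim
    case (elim n)
    show ?case
    proof
      assume s2: "(predictive_sd f P0 n p)\<^sup>2 \<le> 2"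
      have s: "predictive_sd f P0 n p > 0" using predictive_sd_ge_1[OF P0, of f n p] by linarith
      have "(p (Suc n))\<^sup>2 = (predictive_sd f P0 n p)\<^sup>2 * (p (Suc n) / predictive_sd f P0 n p)\<^sup>2"
        using s by (simp add: power_divide)
      also have "\<dots> \<le> 2 * (8 * ln (real (Suc n)))"
        using s2 elim by (intro mult_mono) auto
      also have "\<dots> = (4 * sqrt (ln (real (Suc n))))\<^sup>2"
        by (simp add: power_mult_distrib)
      finally have "\<bar>p (Suc n)\<bar>\<^sup>2 \<le> (4 * sqrt (ln (real (Suc n))))\<^sup>2" by simp
      then have "\<bar>p (Suc n)\<bar> \<le> 4 * sqrt (ln (real (Suc n)))"
        by (rule power2_le_imp_le) simp
      then have "\<bar>f (p (Suc n))\<bar> \<le> C * (1 + 4 * sqrt (ln (real (Suc n)))) powr a"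
        using C a by (intro order_trans[OF fC] mult_left_mono powr_mono2) auto
      then have "\<bar>f (p (Suc n))\<bar>\<^sup>2 \<le> (C * (1 + 4 * sqrt (ln (real (Suc n)))) powr a)\<^sup>2"
        by (intro power_mono) auto
      then have "(f (p (Suc n)))\<^sup>2 \<le> information f P0 (Suc n) p"
        using elim by simp
      then show "(predictive_sd f P0 (Suc n) p)\<^sup>2 \<le> 2"
        using information_pos[OF P0, of f "Suc n" p]
        by (simp add: predictive_sd_power2[OF P0] information_Suc[of f P0 "Suc n"] field_simps)
    qed
  qed
qed

text \<open>Late outputs satisfy
  \<open>(p (Suc i))\<^sup>2 \<le> 2 * (p (Suc i) / s i)\<^sup>2\<close>, so their sum grows at most
  like \<open>8 * t\<close>; the finitely many early ones contribute the constant
  \<open>A\<close>.\<close>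

lemma bounded_mean_square:
  assumes small: "\<forall>\<^sub>F n in sequentially. (s n)\<^sup>2 \<le> (2::real)" and pos: "\<And>n. s n > 0"
    and sum: "\<forall>\<^sub>F n in sequentially. (\<Sum>i<n. (p (Suc i) / s i)\<^sup>2) \<le> 4 * real n"
  shows "(SUP t\<in>{1..}. ereal (1 / real t * (\<Sum>i=1..t. (p i)\<^sup>2))) < \<infinity>"
proof -
  obtain N where N: "\<And>n. n \<ge> N \<Longrightarrow> (s n)\<^sup>2 \<le> 2" "\<And>n. n \<ge> N \<Longrightarrow> (\<Sum>i<n. (p (Suc i) / s i)\<^sup>2) \<le> 4 * real n"
    using eventually_conj[OF small sum] unfolding eventually_sequentially by blast
  define A where "A = (\<Sum>i<N. (p (Suc i))\<^sup>2)"
  have A: "A \<ge> 0" by (simp add: A_def sum_nonneg)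
  have summand: "(p (Suc i))\<^sup>2 \<le> (if i < N then (p (Suc i))\<^sup>2 else 0) + 2 * (p (Suc i) / s i)\<^sup>2" for i
  proof (cases "i < N")
    case False
    have "(p (Suc i))\<^sup>2 = (s i)\<^sup>2 * (p (Suc i) / s i)\<^sup>2" using pos[of i] by (simp add: power_divide)
    also have "\<dots> \<le> 2 * (p (Suc i) / s i)\<^sup>2" using N(1)[of i] False by (intro mult_right_mono) auto
    finally show ?thesis using False by simp
  qed simp
  have le: "(\<Sum>i<t. (p (Suc i))\<^sup>2) \<le> A + 8 * real t" for t
  proof (cases "t \<ge> N")
    case True
    have "(\<Sum>i<t. (p (Suc i))\<^sup>2) \<le> (\<Sum>i<t. (if i < N then (p (Suc i))\<^sup>2 else 0) + 2 * (p (Suc i) / s i)\<^sup>2)"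
      by (intro sum_mono summand)
    also have "\<dots> = (\<Sum>i<t. if i < N then (p (Suc i))\<^sup>2 else 0) + 2 * (\<Sum>i<t. (p (Suc i) / s i)\<^sup>2)"
      by (simp add: sum.distrib sum_distrib_left)
    also have "(\<Sum>i<t. if i < N then (p (Suc i))\<^sup>2 else 0) = A"
      unfolding A_def using True by (intro sum.mono_neutral_cong_right) auto
    finally show ?thesis using N(2)[OF True] by simp
  next
    case False
    then have "(\<Sum>i<t. (p (Suc i))\<^sup>2) \<le> A"
      unfolding A_def by (intro sum_mono2) auto
    then show ?thesis by (simp add: add_increasing2)
  qed
  have "(SUP t\<in>{1..}. ereal (1 / real t * (\<Sum>i=1..t. (p i)\<^sup>2))) \<le> ereal (A + 8)"
  proof (rule SUP_least)
    fix t :: nat assume "t \<in> {1..}"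
    then have t: "1 \<le> t" by simp
    have "(\<Sum>i=1..t. (p i)\<^sup>2) = (\<Sum>i<t. (p (Suc i))\<^sup>2)"
      by (rule sum.reindex_bij_witness[of _ Suc "\<lambda>i. i - 1"]) auto
    also have "\<dots> \<le> A + 8 * real t" by (rule le)
    also have "\<dots> \<le> (A + 8) * real t"
      using mult_left_mono[of 1 "real t" A] A t by (simp add: algebra_simps)
    finally show "ereal (1 / real t * (\<Sum>i=1..t. (p i)\<^sup>2)) \<le> ereal (A + 8)"
      using t by (simp add: field_simps)
  qed
  then show ?thesis by (rule order_le_less_trans) simp
qed

text \<open>The support of \<open>f\<close> is covered by countably many bounded level sets, so one
  of them has positive measure.\<close>

lemma positive_measure_level_set:
  fixes f :: "real \<Rightarrow> real"
  assumes [measurable]: "f \<in> borel_measurable borel" and nonzero: "emeasure lborel {x. f x \<noteq> 0} \<noteq> 0"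
  shows "\<exists>\<epsilon>>0. \<exists>R\<ge>0. measure lborel {x. \<bar>x\<bar> \<le> R \<and> \<epsilon> \<le> (f x)\<^sup>2} > 0"
proof -
  define E where "E k = {x. \<bar>x\<bar> \<le> real k \<and> 1 / real (Suc k) \<le> (f x)\<^sup>2}" for k
  have [measurable]: "E k \<in> sets borel" for k
    unfolding E_def by measurable
  have "{x. f x \<noteq> 0} \<subseteq> (\<Union>k. E k)"
  proof
    fix x assume "x \<in> {x. f x \<noteq> 0}"
    then have pos: "(f x)\<^sup>2 > 0" by simp
    obtain k1 :: nat where k1: "\<bar>x\<bar> \<le> real k1" using real_arch_simple by blast
    obtain k2 :: nat where k2: "1 / real (Suc k2) < (f x)\<^sup>2" using nat_approx_posE[OF pos] by blast
    have "1 / real (Suc (max k1 k2)) \<le> 1 / real (Suc k2)"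
      by (intro divide_left_mono) auto
    then have "x \<in> E (max k1 k2)" using k1 k2 by (auto simp: E_def)
    then show "x \<in> (\<Union>k. E k)" by blast
  qed
  then have "emeasure lborel {x. f x \<noteq> 0} \<le> emeasure lborel (\<Union>k. E k)"
    by (intro emeasure_mono) auto
  with nonzero have "emeasure lborel (\<Union>k. E k) \<noteq> 0"
    by (metis le_zero_eq)
  moreover have "range E \<subseteq> sets lborel" by auto
  ultimately obtain k where k: "emeasure lborel (E k) \<noteq> 0"
    using emeasure_UN_eq_0[of lborel E] by blast
  have "bounded (E k)"
    by (rule bounded_subset[of "{- real k..real k}"]) (auto simp: E_def)
  then have "emeasure lborel (E k) < \<infinity>" by (rule emeasure_bounded_finite)
  with k have "measure lborel (E k) > 0"
    by (simp add: measure_def enn2real_positive_iff zero_less_iff_neq_zero)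
  then show ?thesis
    unfolding E_def by (intro exI[of _ "1 / real (Suc k)"] conjI exI[of _ "real k"]) auto
qed

context certainty_equivalence
begin

lemma AE_predictive_sd_stays_small:
  assumes a: "a \<ge> 0" and C: "C \<ge> 1" and fC: "\<And>x. \<bar>f x\<bar> \<le> C * (1 + \<bar>x\<bar>) powr a"
  shows "AE \<omega> in M. \<forall>\<^sub>F n in sequentially. (sc n (outputs \<omega>))\<^sup>2 \<le> 2 \<longrightarrow> (sc (Suc n) (outputs \<omega>))\<^sup>2 \<le> 2"
proof (cases "emeasure lborel {x. f x \<noteq> 0} = 0")
  case True
  have "AE \<omega> in M. \<forall>n. y (Suc n) \<omega> \<notin> {x. f x \<noteq> 0}"
    by (rule AE_output_not_in_null_set[OF _ True]) measurable
  then show ?thesis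
  proof eventually_elim
    case (elim \<omega>)
    have "(sc (Suc n) (outputs \<omega>))\<^sup>2 = 1" for n
      using elim information_pos[OF P0, of f "Suc n" "outputs \<omega>"]
      by (simp add: predictive_sd_power2[OF P0] information_Suc[of f P0 "Suc n"])
    then show ?case by simp
  qed
next
  case False
  obtain \<epsilon> R where "\<epsilon> > 0" "R \<ge> 0" "measure lborel {x. \<bar>x\<bar> \<le> R \<and> \<epsilon> \<le> (f x)\<^sup>2} > 0"
    using positive_measure_level_set[OF f_measurable False] by blast
  from AE_information_growth[OF this] obtain \<kappa> where \<kappa>: "\<kappa> > 0"
    "AE \<omega> in M. \<forall>\<^sub>F n in sequentially. \<kappa> * real n \<le> info (Suc n) (outputs \<omega>)"
    by blast
  show ?thesis
    using \<kappa>(2) AE_innovation_log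
  proof eventually_elim
    case (elim \<omega>)
    show ?case
      by (rule eventually_predictive_sd_stays_small[OF P0 a C fC _ \<kappa>(1) elim(1)]) (use elim(2) in \<open>simp add: innovation_def\<close>)
  qed
qed

text \<open>On the intersection of four almost sure events the argument is pathwise: some late time
  has variance at most 2, and from then on this persists.\<close>

lemma AE_bounded_mean_square:
  assumes a: "a \<ge> 4"
    and growth: "C \<ge> 1" "\<And>x. \<bar>f x\<bar> \<le> C * (1 + \<bar>x\<bar>) powr a"
    and b: "b < (1 + x_min a)\<^sup>2" and L: "L > 0"
    and dense: "c0 > 0" "l0 \<ge> exp (exp 1)" "\<And>l. l \<ge> l0 \<Longrightarrow> c0 * l / ln (ln l) \<le> measure lborel (S_set f b L \<inter> {-l..l})"
  shows "AE \<omega> in M. (SUP t\<in>{1..}. ereal (1 / real t * (\<Sum>i=1..t. (y i \<omega>)\<^sup>2))) < \<infinity>"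
proof -
  have z: "(1 + x_min a)\<^sup>2 = a * (1 + x_min a) - a" "1 < 1 + x_min a" "1 + x_min a \<le> 2"
    using x_min_properties[OF a] by auto
  have \<beta>: "0 \<le> max b 1" "max b 1 < (1 + x_min a)\<^sup>2"
    using b power_strict_mono[of 1 "1 + x_min a" 2] z(2) by auto
  define C' where "C' = L + C * 2 powr a"
  have "1 * 1 \<le> C * 2 powr a"
    using growth(1) a by (intro mult_mono ge_one_powr_ge_zero) auto
  then have C': "C' \<ge> 1" using L by (simp add: C'_def)
  have fS: "\<bar>f x\<bar> \<le> C' * \<sigma> powr max b 1" if "x \<in> S_set f b L" "\<bar>x\<bar> \<le> \<sigma>" "\<sigma> \<ge> 1" for x \<sigma>
    unfolding C'_def by (rule S_set_bound[OF growth(2,1) _ L that]) (use a in auto)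
  have S: "S_set f b L \<in> sets borel"
    unfolding S_set_def by measurable
  have a0: "a \<ge> 0" using a by simp
  have hits: "AE \<omega> in M. \<forall>T K :: nat. \<exists>t\<ge>T. sc t (outputs \<omega>) \<ge> l0 \<and>
      ln (ln (sc t (outputs \<omega>))) \<le> real (Suc K * Suc t) \<longrightarrow>
      \<bar>y (Suc t) \<omega>\<bar> \<le> sc t (outputs \<omega>) \<and> y (Suc t) \<omega> \<in> S_set f b L"
    by (rule AE_hits[OF S dense(1,2)]) (rule dense(3))
  show ?thesis
    using AE_innovation_log AE_innovation_sum AE_predictive_sd_stays_small[OF a0 growth] hits
  proof eventually_elim
    case (elim \<omega>)
    obtain N where N: "\<And>n. n \<ge> N \<Longrightarrow> (sc n (outputs \<omega>))\<^sup>2 \<le> 2 \<Longrightarrow> (sc (Suc n) (outputs \<omega>))\<^sup>2 \<le> 2"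
      using elim(3) unfolding eventually_sequentially by blast
    obtain n0 where n0: "n0 \<ge> N" "(sc n0 (outputs \<omega>))\<^sup>2 \<le> 2"
      using frequently_small_predictive_sd[OF P0 a z \<beta> growth C' fS, of "S_set f b L" "outputs \<omega>" l0 N] elim(1,4)
      by (auto simp: innovation_def)
    have "(sc n (outputs \<omega>))\<^sup>2 \<le> 2" if "n \<ge> n0" for n
      using that by (induction n rule: dec_induct) (use n0 N in auto)
    then have "\<forall>\<^sub>F n in sequentially. (sc n (outputs \<omega>))\<^sup>2 \<le> 2"
      unfolding eventually_sequentially by blast
    then show ?case
      by (rule bounded_mean_square) (use sc_pos elim(2) in \<open>simp_all add: innovation_def\<close>)
  qed
qed

end

theorem theorem2p3:
  fixes M :: "'w measure" and f :: "real \<Rightarrow> real"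
    and \<theta> :: "'w \<Rightarrow> real" and w :: "nat \<Rightarrow> 'w \<Rightarrow> real"
    and \<theta>0 P0 a :: real
  assumes "prob_space M"
    and "piecewise_continuous f"
    and A1_indep: "prob_space.indep_vars M (\<lambda>_. borel) w {1..}"
    and A1_normal: "\<And>t. t \<ge> 1 \<Longrightarrow> distributed M lborel (w t) (normal_density 0 1)"
    and A2_normal: "P0 > 0" "distributed M lborel \<theta> (normal_density \<theta>0 (sqrt P0))"
    and A2_indep: "independent_rv M borel \<theta> (\<Pi>\<^sub>M t\<in>{1..}. borel) (noise w)"
    and growth: "a \<ge> 4"
      "\<exists>h1\<in>O[at_infinity](\<lambda>x. \<bar>x\<bar> powr a). \<exists>h2\<in>O[at_infinity](\<lambda>_. 1). \<forall>x. \<bar>f x\<bar> = h1 x + h2 x"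
    and small: "\<exists>b L. b < (1 + x_min a)\<^sup>2 \<and> L > 0 \<and>
      Liminf at_top (\<lambda>l::real.
        ereal (measure lebesgue (S_set f b L \<inter> {-l..l}) / l * ln (ln l))) > 0"
  shows "globally_stabilizable M f \<theta> w"
proof -
  interpret prob_space M by fact
  have f: "f \<in> borel_measurable borel"
    by (rule piecewise_continuous_borel_measurable) fact
  obtain b L where b: "b < (1 + x_min a)\<^sup>2" "L > 0"
    and liminf: "Liminf at_top (\<lambda>l::real. ereal (measure lebesgue (S_set f b L \<inter> {-l..l}) / l * ln (ln l))) > 0"
    using small by blast
  obtain c0 l0 where dense: "c0 > 0" "l0 \<ge> exp (exp 1)"
    "\<And>l. l \<ge> l0 \<Longrightarrow> c0 * l / ln (ln l) \<le> measure lborel (S_set f b L \<inter> {-l..l})"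
    using S_set_density[OF f liminf] by blast
  obtain C where C: "C \<ge> 1" "\<And>x. \<bar>f x\<bar> \<le> C * (1 + \<bar>x\<bar>) powr a"
    using polynomial_growth_bound[OF \<open>piecewise_continuous f\<close> _ growth(2)] growth(1) by auto
  show ?thesis
    unfolding globally_stabilizable_def
  \<comment> \<open>The law depends on the prior of \<open>\<theta>\<close> and on \<open>f\<close>,
    but not on the initial value, so it is chosen before \<open>y0\<close> is fixed.\<close>
  proof (intro exI[of _ "ce_law f \<theta>0 P0"] conjI allI impI)
    show "feedback_law (ce_law f \<theta>0 P0)"
      by (rule feedback_law_ce_law) (rule f)
    fix y0 y
    assume "admissible_initial M \<theta> w y0 \<and> closed_loop M f \<theta> w (ce_law f \<theta>0 P0) y0 y"
    then interpret certainty_equivalence M f \<theta> w \<theta>0 P0 y0 y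
      using f A1_indep A1_normal A2_normal A2_indep by unfold_locales auto
    show "AE \<omega> in M. (SUP t\<in>{1..}. ereal (1 / real t * (\<Sum>i=1..t. (y i \<omega>)\<^sup>2))) < \<infinity>"
      by (rule AE_bounded_mean_square[OF growth(1) C b dense])
  qed
qed

end
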